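(* Let $\rho>0$, $\beta\in(0,1)$, and let $\mathbf{X}\in\mathbb{R}^{d\times n}$ have all columns in $\mathcal{B}_d$. Run $\mathrm{SeparateCov}$ on $\mathbf{X}$ with parameter $\rho$. Then with probability at least $1-\beta$ the output satisfies $$\|\widetilde{\mathbf{\Sigma}}_{\mathrm{Sep}}-\mathbf{\Sigma}\|_F\le \frac{2^{1.25}\sqrt{\mathrm{tr}}}{\rho^{1/4}\sqrt n}\sqrt{\upsilon(d,\beta/2)}+\frac{\sqrt2}{\sqrt\rho\, n}\,\eta(d,\beta/2),$$ in particular $\|\widetilde{\mathbf{\Sigma}}_{\mathrm{Sep}}-\mathbf{\Sigma}\|_F=\tilde O\big(d^{1/4}\sqrt{\mathrm{tr}}/\sqrt n+\sqrt d/n\big)$, where $\tilde O$ hides dependence on $\rho,\beta$ and polylogarithmic factors.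
   Context: $\mathcal{B}_d$ is the closed unit $\ell_2$-ball in $\mathbb{R}^d$. $\mathbf{\Sigma}=\frac1n\mathbf{X}\mathbf{X}^T$ with eigendecomposition $\mathbf{\Sigma}=\mathbf{P}\mathbf{\Lambda}\mathbf{P}^T$, $\mathbf{\Lambda}=\mathrm{diag}(\lambda_1,\dots,\lambda_d)$, $\lambda_1\ge\dots\ge\lambda_d$, and $\mathrm{tr}=\sum_k\lambda_k=\frac1n\sum_i\|X_i\|_2^2$. For a symmetric matrix $\mathbf{A}$, $\mathbf{P}[\mathbf{A}]$ denotes an orthogonal matrix whose $j$-th column is a unit eigenvector for the $j$-th largest eigenvalue of $\mathbf{A}$. $\mathrm{SGW}(d)$ is the law of a symmetric $d\times d$ random matrix $\mathbf{W}$ with $w_{j,k}\sim\mathcal{N}(0,1)$ i.i.d. for $j\le k$ and $w_{k,j}=w_{j,k}$. $\mathrm{GaussCov}(\mathbf{X},\rho')$ outputs $\mathbf{\Sigma}+\frac{1}{\sqrt{\rho'}n}\mathbf{W}$ with $\mathbf{W}\sim\mathrm{SGW}(d)$. $\mathrm{SeparateCov}(\mathbf{X},\rho)$: (1) set $\widetilde{\mathbf{\Lambda}}_{\mathrm{Sep}}=\mathbf{\Lambda}+\frac{\sqrt2}{\sqrt\rho n}\mathrm{diag}(Y)$ with $Y\sim\mathcal{N}(0,\mathbf{I}_d)$; (2) set $\widetilde{\mathbf{\Sigma}}_{\mathrm{Gau}}=\mathrm{GaussCov}(\mathbf{X},\rho/2)$ (independent noise); (3) $\widetilde{\mathbf{P}}_{\mathrm{Sep}}=\mathbf{P}[\widetilde{\mathbf{\Sigma}}_{\mathrm{Gau}}]$;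 (4) output $\widetilde{\mathbf{\Sigma}}_{\mathrm{Sep}}=\widetilde{\mathbf{P}}_{\mathrm{Sep}}\widetilde{\mathbf{\Lambda}}_{\mathrm{Sep}}\widetilde{\mathbf{P}}_{\mathrm{Sep}}^T$. The functions are $\eta(d,\beta)=\sqrt{d+2\sqrt{d\log(1/\beta)}+2\log(1/\beta)}$ and $$\upsilon(d,\beta)=2\sqrt d+2d^{1/6}\log^{1/3}d+\frac{6(1+(\log d/d)^{1/3})\sqrt{\log d}}{\sqrt{\log(1+(\log d/d)^{1/3})}}+2\sqrt{2\log(1/\beta)}.$$ Logarithms are natural, with the convention $\log(x)=1$ for $x\le e$. *)

theory Defs
  imports "HOL-Analysis.Analysis" "HOL-Probability.Probability"
begin

type_synonym 'd rmat = "real^'d^'d"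

text \<open>Logarithm with the paper's convention: log x = 1 for x \<le> e, natural log otherwise.\<close>
definition logc :: "real \<Rightarrow> real" where
  "logc x = (if x \<le> exp 1 then 1 else ln x)"

definition eta_fn :: "real \<Rightarrow> real \<Rightarrow> real" where
  "eta_fn d \<beta> = sqrt (d + 2 * sqrt (d * logc (1/\<beta>)) + 2 * logc (1/\<beta>))"

definition upsilon_fn :: "real \<Rightarrow> real \<Rightarrow> real" where
  "upsilon_fn d \<beta> =
     (let \<epsilon> = (logc d / d) powr (1/3) in
       2 * sqrt d + 2 * d powr (1/6) * (logc d) powr (1/3)
       + 6 * (1 + \<epsilon>) * sqrt (logc d) / sqrt (ln (1 + \<epsilon>))
       + 2 * sqrt (2 * logc (1/\<beta>)))"

definition outer :: "real^'d \<Rightarrow> real^'d \<Rightarrow> 'd rmat" where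
  "outer x y = (\<chi> i j. x$i * y$j)"

text \<open>Empirical second moment matrix Sigma = (1/n) X X^T, columns X 0, ..., X (n-1).\<close>
definition emp_cov :: "nat \<Rightarrow> (nat \<Rightarrow> real^'d) \<Rightarrow> 'd rmat" where
  "emp_cov n X = (1 / real n) *\<^sub>R (\<Sum>i<n. outer (X i) (X i))"

definition emp_tr :: "nat \<Rightarrow> (nat \<Rightarrow> real^'d) \<Rightarrow> real" where
  "emp_tr n X = (1 / real n) * (\<Sum>i<n. (norm (X i))\<^sup>2)"

definition diag_mat :: "('d::finite \<Rightarrow> real) \<Rightarrow> 'd rmat" where
  "diag_mat v = (\<chi> i j. if i = j then v i else 0)"

definition frob_norm :: "('d::finite) rmat \<Rightarrow> real" where
  "frob_norm A = sqrt (\<Sum>i\<in>UNIV. \<Sum>j\<in>UNIV. (A$i$j)\<^sup>2)"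

text \<open>P is an orthogonal matrix whose j-th column is a unit eigenvector of A for the
  eigenvalue lam j, and lam is non-increasing along the order of the index type,
  i.e. lam j is the j-th largest eigenvalue of A and P may serve as P[A].\<close>
definition sorted_eig :: "('d::{finite,linorder}) rmat \<Rightarrow> 'd rmat \<Rightarrow> ('d \<Rightarrow> real) \<Rightarrow> bool" where
  "sorted_eig A P lam \<longleftrightarrow> orthogonal_matrix P \<and> (\<forall>i j. i \<le> j \<longrightarrow> lam j \<le> lam i)
     \<and> (\<forall>j. A *v column j P = lam j *\<^sub>R column j P)"

text \<open>Noise space: i.i.d. standard Gaussians indexed by Inl j (vector Y) and
  Inr (j,k) (entries of a Gaussian matrix G, of which the entries with j \<le> k are used).\<close>
definition noise_space :: "('d + 'd \<times> 'd \<Rightarrow> real) measure" where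
  "noise_space = PiM UNIV (\<lambda>_. density lborel std_normal_density)"

definition noise_Y :: "('d + 'd \<times> 'd \<Rightarrow> real) \<Rightarrow> 'd \<Rightarrow> real" where
  "noise_Y \<omega> j = \<omega> (Inl j)"

definition noise_W :: "('d::{finite,linorder} + 'd \<times> 'd \<Rightarrow> real) \<Rightarrow> 'd rmat" where
  "noise_W \<omega> = (\<chi> j k. if j \<le> k then \<omega> (Inr (j,k)) else \<omega> (Inr (k,j)))"

definition gauss_cov :: "nat \<Rightarrow> (nat \<Rightarrow> real^('d::finite)) \<Rightarrow> real \<Rightarrow> 'd rmat \<Rightarrow> 'd rmat" where
  "gauss_cov n X \<rho>' W = emp_cov n X + (1 / (sqrt \<rho>' * real n)) *\<^sub>R W"

text \<open>Output of SeparateCov given the sorted eigenvalues lam of Sigma and the eigenvector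
  matrix Pt = P[GaussCov(X, rho/2)].\<close>
definition sep_cov_out :: "nat \<Rightarrow> real \<Rightarrow> ('d::finite \<Rightarrow> real) \<Rightarrow> ('d \<Rightarrow> real) \<Rightarrow> 'd rmat \<Rightarrow> 'd rmat" where
  "sep_cov_out n \<rho> lam Y Pt =
     Pt ** diag_mat (\<lambda>j. lam j + sqrt 2 / (sqrt \<rho> * real n) * Y j) ** transpose Pt"

end

theory Submission
  imports Defs "HOL-Real_Asymp.Real_Asymp"
begin

text \<open>
  Write \<open>S\<close> for the empirical covariance, \<open>B = S + c W\<close> for its Gaussian perturbation, and
  \<open>D = Q diag(lam) Q\<^sup>T\<close> where \<open>Q\<close> diagonalises \<open>B\<close>. By the rearrangement inequality
  \<open>\<langle>B, D\<rangle> = \<Sum> lam j * mu j \<ge> \<langle>B, S\<rangle>\<close>. As \<open>D\<close> and \<open>S\<close> have the same spectrum, this gives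
  \<open>|D - S|\<^sup>2 = 2 \<langle>S, S - D\<rangle> \<le> 2 c \<langle>W, D - S\<rangle> \<le> 4 c |W| tr S\<close>, and perturbing the eigenvalues
  adds exactly \<open>c |Y|\<close>.

  The norm of \<open>Y\<close> is controlled by the Laurent--Massart chi-square tail. For the operator norm of
  \<open>W\<close>, Slepian's inequality compares \<open>\<plusminus> u \<bullet> W u \<plusminus> sqrt (2 + \<Sum> u\<^sub>j\<^sup>4) z\<close> with \<open>2 g \<bullet> u\<close> over a finite net
  of the sphere. One of the two signs of \<open>z\<close> does not decrease the supremum, so \<open>z\<close> costs only a
  factor 2, and the supremum of \<open>2 g \<bullet> u\<close> is at most \<open>2 |g|\<close>, again a chi-square quantity. The
  resulting bound has leading term \<open>2 sqrt d\<close> and is smaller than \<open>\<upsilon>\<close> by a constant, which pays for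
  the union bounds and the net.
\<close>

section \<open>Rearrangement and the deterministic error bound\<close>

text \<open>A dual potential for the transport problem with cost \<open>- lam j * mu k\<close>, for which the
  identity coupling is optimal because both sequences are sorted the same way.\<close>
lemma rearrangement_potential:
  fixes lam mu :: "'d::linorder \<Rightarrow> real"
  assumes "finite A"
    and "\<And>i j. i \<le> j \<Longrightarrow> lam j \<le> lam i" "\<And>i j. i \<le> j \<Longrightarrow> mu j \<le> mu i"
  shows "\<exists>\<alpha>. \<forall>j\<in>A. \<forall>k\<in>A. mu k * (lam j - lam k) \<le> \<alpha> j - \<alpha> k"
  using assms(1)
proof (induction A rule: finite_linorder_max_induct)
  case empty
  then show ?case by simp
next
  case (insert b A)
  then obtain \<alpha> where \<alpha>: "\<And>j k. j \<in> A \<Longrightarrow> k \<in> A \<Longrightarrow> mu k * (lam j - lam k) \<le> \<alpha> j - \<alpha> k"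
    by blast
  show ?case
  proof (cases "A = {}")
    case True
    then show ?thesis by simp
  next
    case False
    \<comment> \<open>\<open>m\<close> is the index just before the new maximum \<open>b\<close>.
      The potential at \<open>b\<close> is chosen so that the constraint for the pair
      \<open>(b, m)\<close> holds with equality; monotonicity of \<open>lam\<close> and
      \<open>mu\<close> then carries it to all earlier indices.\<close>
    define m where "m = Max A"
    have mA: "m \<in> A" and mmax: "\<And>k. k \<in> A \<Longrightarrow> k \<le> m"
      using False insert by (auto simp: m_def)
    have mb: "m < b" using insert mA by blast
    have bA: "b \<notin> A" using insert by blast
    define \<alpha>' where "\<alpha>' = \<alpha>(b := \<alpha> m + mu m * (lam b - lam m))"
    have 1: "mu k * (lam b - lam k) \<le> \<alpha>' b - \<alpha>' k" if "k \<in> A" for k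
    proof -
      \<comment> \<open>This product is exactly what is lost when the path from \<open>b\<close> to
        \<open>k\<close> passes through \<open>m\<close>; both of its factors are
        nonpositive.\<close>
      have "(mu m - mu k) * (lam b - lam m) \<ge> 0"
        using assms(2)[of m b] assms(3)[OF mmax[OF that]] mb by (intro mult_nonpos_nonpos) auto
      then show ?thesis
        using \<alpha>[OF mA that] bA that by (auto simp: \<alpha>'_def algebra_simps)
    qed
    have 2: "mu b * (lam j - lam b) \<le> \<alpha>' j - \<alpha>' b" if "j \<in> A" for j
    proof -
      have "(mu m - mu b) * (lam j - lam b) \<ge> 0"
        using assms(3)[of m b] assms(2)[of j b] mb mmax[OF that] by (intro mult_nonneg_nonneg) auto
      then show ?thesis
        using \<alpha>[OF that mA] bA that by (auto simp: \<alpha>'_def algebra_simps)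
    qed
    have 3: "mu k * (lam j - lam k) \<le> \<alpha>' j - \<alpha>' k" if "j \<in> A" "k \<in> A" for j k
      using \<alpha>[OF that] bA that by (auto simp: \<alpha>'_def)
    show ?thesis
      by (rule exI[of _ \<alpha>']) (use 1 2 3 in auto)
  qed
qed

text \<open>Weak duality: the potential bounds \<open>lam j * mu k\<close> by a function of
  \<open>j\<close> plus a function of \<open>k\<close>. Summing against \<open>S\<close>, the row
  and column sums collapse and \<alpha> cancels. It is applied to the squared inner products of two
  orthonormal bases.\<close>

lemma doubly_stochastic_rearrangement:
  fixes lam mu :: "'d::{finite,linorder} \<Rightarrow> real"
  assumes "\<And>i j. i \<le> j \<Longrightarrow> lam j \<le> lam i" "\<And>i j. i \<le> j \<Longrightarrow> mu j \<le> mu i"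
    and nonneg: "\<And>j k. 0 \<le> S j k"
    and row: "\<And>j. (\<Sum>k\<in>UNIV. S j k) = 1" and col: "\<And>k. (\<Sum>j\<in>UNIV. S j k) = 1"
  shows "(\<Sum>j\<in>UNIV. \<Sum>k\<in>UNIV. lam j * mu k * S j k) \<le> (\<Sum>k\<in>UNIV. lam k * mu k)"
proof -
  obtain \<alpha> where \<alpha>: "\<And>j k. mu k * (lam j - lam k) \<le> \<alpha> j - \<alpha> k"
    using rearrangement_potential[of "UNIV::'d set" lam mu, OF finite assms(1,2)] by auto
  have "(\<Sum>j\<in>UNIV. \<Sum>k\<in>UNIV. lam j * mu k * S j k)
      \<le> (\<Sum>j\<in>UNIV. \<Sum>k\<in>UNIV. \<alpha> j * S j k + (lam k * mu k - \<alpha> k) * S j k)"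
    unfolding distrib_right[symmetric]
    by (intro sum_mono mult_right_mono nonneg) (use \<alpha> in \<open>auto simp: algebra_simps\<close>)
  also have "\<dots> = (\<Sum>j\<in>UNIV. \<Sum>k\<in>UNIV. \<alpha> j * S j k)
      + (\<Sum>k\<in>UNIV. \<Sum>j\<in>UNIV. (lam k * mu k - \<alpha> k) * S j k)"
    unfolding sum.distrib by (subst (2) sum.swap) simp
  also have "\<dots> = (\<Sum>k\<in>UNIV. lam k * mu k)"
    by (simp add: sum_distrib_left[symmetric] row col sum_subtractf)
  finally show ?thesis .
qed

section \<open>Frobenius geometry and orthonormal eigenbases\<close>

lemma frob_norm_eq_norm: "frob_norm A = norm A"
  by (simp add: frob_norm_def norm_vec_def L2_set_def real_sqrt_pow2 sum_nonneg)

lemma inner_outer: "A \<bullet> outer x y = x \<bullet> (A *v y)"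
  by (simp add: inner_vec_def outer_def matrix_vector_mult_def sum_distrib_left mult_ac)

lemma outer_inner_outer: "outer x x \<bullet> outer y y = (x \<bullet> y)\<^sup>2"
  unfolding inner_outer
  by (simp add: inner_vec_def outer_def matrix_vector_mult_def power2_eq_square sum_product
      sum_distrib_left sum_distrib_right mult_ac)

lemma column_inner_column:
  fixes Q :: "'d::finite rmat"
  assumes "orthogonal_matrix Q"
  shows "column j Q \<bullet> column k Q = (if j = k then 1 else 0)"
  using assms by (auto simp: orthogonal_matrix_orthonormal_columns norm_eq_1 pairwise_def orthogonal_def)

text \<open>Parseval's identity for the columns, since the transpose of an orthogonal matrix is an
  isometry.\<close>

lemma sum_inner_columns_sq:
  fixes Q :: "'d::finite rmat"
  assumes "orthogonal_matrix Q"
  shows "(\<Sum>k\<in>UNIV. (x \<bullet> column k Q)\<^sup>2) = (norm x)\<^sup>2"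
proof -
  have "(norm (x v* Q))\<^sup>2 = (\<Sum>k\<in>UNIV. (x \<bullet> column k Q)\<^sup>2)"
    by (simp add: norm_vec_def L2_set_def sum_nonneg vector_matrix_mult_def column_def inner_vec_def mult_ac)
  moreover have "orthogonal_matrix (transpose Q)" using assms by simp
  then have "norm (transpose Q *v x) = norm x"
    using orthogonal_transformation_matrix[of "(*v) (transpose Q)"]
    by (simp add: orthogonal_transformation)
  ultimately show ?thesis by simp
qed

lemma orthogonal_columns_expand:
  fixes Q :: "'d::finite rmat"
  assumes "orthogonal_matrix Q"
  shows "(\<Sum>k\<in>UNIV. (x \<bullet> column k Q) *\<^sub>R column k Q) = x"
proof -
  have "(\<Sum>k\<in>UNIV. (x \<bullet> column k Q) *\<^sub>R column k Q) = Q *v (transpose Q *v x)"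
    by (simp add: vec_eq_iff matrix_vector_mult_def transpose_def column_def inner_vec_def mult_ac)
  also have "\<dots> = x"
    unfolding matrix_vector_mul_assoc using assms by (simp add: orthogonal_matrix_def)
  finally show ?thesis .
qed

text \<open>The rank-one form of a spectral decomposition. With \<open>inner_outer\<close> it turns
  Frobenius inner products into weighted sums of quadratic forms.\<close>

lemma conj_diag_mat:
  "Q ** diag_mat v ** transpose Q = (\<Sum>j\<in>UNIV. v j *\<^sub>R outer (column j Q) (column j Q))"
proof -
  have 1: "(Q ** diag_mat v) $ i $ k = v k * Q $ i $ k" for i k
  proof -
    have "(Q ** diag_mat v) $ i $ k = (\<Sum>l\<in>UNIV. if l = k then v l * Q $ i $ l else 0)"
      unfolding matrix_matrix_mult_def diag_mat_def vec_lambda_beta by (rule sum.cong) auto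
    then show ?thesis by simp
  qed
  have "(Q ** diag_mat v ** transpose Q) $ i $ j = (\<Sum>k\<in>UNIV. v k * (Q $ i $ k * Q $ j $ k))" for i j
    unfolding matrix_matrix_mult_def[of "Q ** diag_mat v"] vec_lambda_beta 1 transpose_def
    by (simp only: mult.assoc)
  then show ?thesis
    by (simp only: vec_eq_iff sum_component vector_scaleR_component outer_def column_def
        vec_lambda_beta real_scaleR_def) blast
qed

lemma quadform_eigenbasis:
  fixes B Q :: "'d::finite rmat"
  assumes "orthogonal_matrix Q" and "\<And>k. B *v column k Q = mu k *\<^sub>R column k Q"
  shows "x \<bullet> (B *v x) = (\<Sum>k\<in>UNIV. mu k * (x \<bullet> column k Q)\<^sup>2)"
proof -
  have "B *v x = B *v (\<Sum>k\<in>UNIV. (x \<bullet> column k Q) *\<^sub>R column k Q)"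
    using orthogonal_columns_expand[OF assms(1), of x] by simp
  also have "\<dots> = (\<Sum>k\<in>UNIV. (x \<bullet> column k Q) *\<^sub>R (mu k *\<^sub>R column k Q))"
    by (simp add: linear_sum[OF matrix_vector_mul_linear] linear_cmul[OF matrix_vector_mul_linear] assms)
  finally show ?thesis
    by (simp add: inner_sum_right power2_eq_square mult_ac)
qed

lemma eigenbasis_decomposition:
  fixes S P :: "'d::finite rmat"
  assumes "orthogonal_matrix P" and "\<And>k. S *v column k P = lam k *\<^sub>R column k P"
  shows "S = P ** diag_mat lam ** transpose P"
proof -
  have "S ** P = P ** diag_mat lam"
  proof -
    have "(S ** P) $ i $ j = (P ** diag_mat lam) $ i $ j" for i j
    proof -
      have "(S ** P) $ i $ j = (S *v column j P) $ i"
        by (simp add: matrix_matrix_mult_def matrix_vector_mult_def column_def)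
      also have "\<dots> = (P ** diag_mat lam) $ i $ j"
        unfolding assms(2) by (simp add: matrix_matrix_mult_def diag_mat_def column_def if_distrib mult_ac cong: if_cong)
      finally show ?thesis .
    qed
    then show ?thesis by (simp add: vec_eq_iff)
  qed
  then have "S ** (P ** transpose P) = P ** diag_mat lam ** transpose P"
    by (simp add: matrix_mul_assoc)
  then show ?thesis
    using assms(1) by (simp add: orthogonal_matrix_def)
qed

lemma norm_conj_diag_mat_sq:
  fixes Q :: "'d::finite rmat"
  assumes "orthogonal_matrix Q"
  shows "(norm (Q ** diag_mat v ** transpose Q))\<^sup>2 = (\<Sum>j\<in>UNIV. (v j)\<^sup>2)"
proof -
  have "(\<Sum>k\<in>UNIV. v k * (column k Q \<bullet> column j Q)\<^sup>2) = v j" for j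
  proof -
    have "(\<Sum>k\<in>UNIV. v k * (column k Q \<bullet> column j Q)\<^sup>2) = (\<Sum>k\<in>UNIV. if k = j then v k else 0)"
      by (rule sum.cong) (auto simp: column_inner_column[OF assms])
    then show ?thesis by simp
  qed
  then show ?thesis
    unfolding conj_diag_mat power2_norm_eq_inner inner_sum_left inner_sum_right
      inner_scaleR_left inner_scaleR_right outer_inner_outer
    by (simp add: power2_eq_square)
qed

lemma emp_cov_quadform:
  fixes X :: "nat \<Rightarrow> real^'d::finite"
  shows "x \<bullet> (emp_cov n X *v x) = (1 / real n) * (\<Sum>i<n. (X i \<bullet> x)\<^sup>2)"
  unfolding inner_outer[symmetric] emp_cov_def inner_scaleR_left inner_sum_left outer_inner_outer ..

section \<open>Operator norm of a symmetric matrix from a finite net\<close>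

lemma quadform_polarization_bound:
  fixes W :: "'d::finite rmat"
  assumes sym: "\<And>x y. x \<bullet> (W *v y) = y \<bullet> (W *v x)"
    and K: "\<And>x. \<bar>x \<bullet> (W *v x)\<bar> \<le> K * (norm x)\<^sup>2"
    and xy: "norm x \<le> 1" "norm y \<le> 1" and "K \<ge> 0"
  shows "\<bar>x \<bullet> (W *v y)\<bar> \<le> K"
proof -
  \<comment> \<open>Polarization reduces the bilinear form to the quadratic one; the parallelogram
    law below bounds the total of the two squared norms by 4.\<close>
  have eq: "4 * (x \<bullet> (W *v y)) = (x + y) \<bullet> (W *v (x + y)) - (x - y) \<bullet> (W *v (x - y))"
    using sym[of x y]
    by (simp add: matrix_vector_right_distrib matrix_vector_mult_diff_distrib inner_add_left
        inner_add_right inner_diff_left inner_diff_right)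
  have "4 * \<bar>x \<bullet> (W *v y)\<bar> \<le> K * ((norm (x + y))\<^sup>2 + (norm (x - y))\<^sup>2)"
    using K[of "x + y"] K[of "x - y"] eq by (simp add: distrib_left)
  also have "(norm (x + y))\<^sup>2 + (norm (x - y))\<^sup>2 = 2 * (norm x)\<^sup>2 + 2 * (norm y)\<^sup>2"
    by (simp add: power2_norm_eq_inner inner_add_left inner_add_right inner_diff_left inner_diff_right)
  also have "K * \<dots> \<le> K * 4"
    using xy \<open>K \<ge> 0\<close> power_mono[OF xy(1), of 2] power_mono[OF xy(2), of 2]
    by (intro mult_left_mono) auto
  finally show ?thesis by simp
qed

text \<open>Let \<open>m\<close> maximise the form in modulus on the sphere, with value
  \<open>K\<close>, and let \<open>v\<close> be a net point near it. By symmetry the forms at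
  \<open>m\<close> and \<open>v\<close> differ by \<open>(m - v) \<bullet> (W *v (m + v))\<close>,
  which is at most \<open>2 * \<delta> * K\<close> in modulus, so \<open>K\<close> can be
  absorbed.\<close>

lemma quadform_net_bound:
  fixes W :: "'d::finite rmat"
  assumes sym: "\<And>x y. x \<bullet> (W *v y) = y \<bullet> (W *v x)"
    and net: "\<And>x::real^'d. norm x = 1 \<Longrightarrow> \<exists>v\<in>N. norm v = 1 \<and> norm (x - v) \<le> \<delta>"
    and \<delta>: "0 < \<delta>" "2 * \<delta> < 1"
    and N: "\<And>v. v \<in> N \<Longrightarrow> \<bar>v \<bullet> (W *v v)\<bar> \<le> (1 - 2 * \<delta>) * T"
    and x: "norm x = 1"
  shows "\<bar>x \<bullet> (W *v x)\<bar> \<le> T"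
proof -
  let ?f = "\<lambda>x. \<bar>x \<bullet> (W *v x)\<bar>"
  have "continuous_on (sphere 0 1) ?f"
    by (intro continuous_intros linear_continuous_on bounded_linear.linear) auto
  moreover have "x \<in> sphere 0 1" using x by simp
  ultimately obtain m where m: "norm m = 1" and max: "\<And>y. norm y = 1 \<Longrightarrow> ?f y \<le> ?f m"
    using continuous_attains_sup[of "sphere (0::real^'d) 1" ?f] by auto
  define K where "K = ?f m"
  have K: "?f y \<le> K * (norm y)\<^sup>2" for y
  proof (cases "y = 0")
    case False
    have "?f ((1 / norm y) *\<^sub>R y) \<le> K"
      unfolding K_def using False by (intro max) simp
    then have "?f y / (norm y)\<^sup>2 \<le> K"
      by (simp add: matrix_vector_mult_scaleR abs_mult power2_eq_square field_simps)
    then show ?thesis using False by (simp add: field_simps)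
  qed simp
  obtain v where v: "v \<in> N" "norm v = 1" "norm (m - v) \<le> \<delta>"
    using net[OF m] by blast
  \<comment> \<open>The scalings put \<open>a\<close> and \<open>b\<close> in the unit ball, and the
    factor \<open>2 * \<delta>\<close> compensates for them.\<close>
  define a where "a = (1 / \<delta>) *\<^sub>R (m - v)"
  define b where "b = (1 / 2) *\<^sub>R (m + v)"
  have "norm a \<le> 1" unfolding a_def norm_scaleR using v \<delta> by (simp add: field_simps)
  moreover have "norm b \<le> 1"
    unfolding b_def norm_scaleR using norm_triangle_ineq[of m v] v m by simp
  ultimately have "\<bar>a \<bullet> (W *v b)\<bar> \<le> K"
    using quadform_polarization_bound[OF sym K] by (simp add: K_def)
  moreover have "m \<bullet> (W *v m) - v \<bullet> (W *v v) = 2 * \<delta> * (a \<bullet> (W *v b))"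
    using sym[of m v] \<delta>
    by (simp add: a_def b_def matrix_vector_mult_scaleR matrix_vector_right_distrib inner_add_right
        inner_diff_left diff_divide_distrib distrib_left right_diff_distrib)
  ultimately have "\<bar>m \<bullet> (W *v m) - v \<bullet> (W *v v)\<bar> \<le> 2 * \<delta> * K"
    using \<delta> by (simp add: abs_mult)
  then have "K \<le> (1 - 2 * \<delta>) * T + 2 * \<delta> * K"
    using N[OF v(1)] unfolding K_def by linarith
  then have "(1 - 2 * \<delta>) * K \<le> (1 - 2 * \<delta>) * T" by (simp add: algebra_simps)
  then have "K \<le> T" using \<delta> by simp
  then show ?thesis using max[OF x] by (simp add: K_def)
qed

text \<open>Compactness supplies the net. Its size is left open because the tail bound for the
  quadratic forms is uniform over finite sets of unit vectors.\<close>

lemma sphere_finite_net: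
  assumes "0 < (\<delta>::real)"
  shows "\<exists>N::(real^'d) set. finite N \<and> (\<forall>v\<in>N. norm v = 1) \<and>
    (\<forall>x. norm x = 1 \<longrightarrow> (\<exists>v\<in>N. norm (x - v) \<le> \<delta>))"
proof -
  obtain N where N: "finite N" "N \<subseteq> sphere (0::real^'d) 1" "sphere 0 1 \<subseteq> (\<Union>x\<in>N. ball x \<delta>)"
    by (rule compactE_image[OF compact_sphere[of "0::real^'d" 1], of "sphere 0 1" "\<lambda>x. ball x \<delta>"])
      (use assms in \<open>auto intro: bexI\<close>)
  have "\<exists>v\<in>N. norm (x - v) \<le> \<delta>" if "norm x = 1" for x
  proof -
    have "x \<in> (\<Union>x\<in>N. ball x \<delta>)" by (rule subsetD[OF N(3)]) (simp add: that)
    then obtain v where "v \<in> N" "dist v x < \<delta>" by auto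
    then show ?thesis by (auto simp: dist_norm norm_minus_commute intro!: bexI[of _ v])
  qed
  moreover have "\<forall>v\<in>N. norm v = 1" using N(2) by auto
  ultimately show ?thesis using N(1) by blast
qed

lemma sep_cov_error_deterministic:
  fixes X :: "nat \<Rightarrow> real^'d::{finite,linorder}"
  assumes c: "c \<ge> 0"
    and P: "sorted_eig (emp_cov n X) P lam"
    and Q: "sorted_eig (emp_cov n X + c *\<^sub>R W) Q mu"
    and T: "\<And>x. norm x = 1 \<Longrightarrow> \<bar>x \<bullet> (W *v x)\<bar> \<le> T"
  shows "norm (Q ** diag_mat (\<lambda>j. lam j + c * Y j) ** transpose Q - emp_cov n X)
    \<le> 2 * sqrt (c * T * emp_tr n X) + c * sqrt (\<Sum>j\<in>UNIV. (Y j)\<^sup>2)"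
proof -
  let ?S = "emp_cov n X"
  let ?B = "?S + c *\<^sub>R W"
  define p where "p j = column j P" for j
  define q where "q j = column j Q" for j
  have oP: "orthogonal_matrix P" and oQ: "orthogonal_matrix Q"
    using P Q by (auto simp: sorted_eig_def)
  have mono_lam: "i \<le> j \<Longrightarrow> lam j \<le> lam i" and mono_mu: "i \<le> j \<Longrightarrow> mu j \<le> mu i" for i j
    using P Q by (auto simp: sorted_eig_def)
  have eP: "?S *v p j = lam j *\<^sub>R p j" and eQ: "?B *v q j = mu j *\<^sub>R q j" for j
    using P Q by (auto simp: sorted_eig_def p_def q_def)
  have np: "norm (p j) = 1" and nq: "norm (q j) = 1" for j
    using column_inner_column[OF oP, of j j] column_inner_column[OF oQ, of j j]
    by (auto simp: p_def q_def norm_eq_1)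
  \<comment> \<open>Writing the eigenvalues as Rayleigh quotients of the data gives both their
    nonnegativity and their sum.\<close>
  have lam_eq: "lam j = (1 / real n) * (\<Sum>i<n. (X i \<bullet> p j)\<^sup>2)" for j
    using emp_cov_quadform[of "p j" n X] np[of j] by (simp add: eP norm_eq_1)
  have lam0: "0 \<le> lam j" for j
    unfolding lam_eq by (intro mult_nonneg_nonneg sum_nonneg) auto
  have tr: "(\<Sum>j\<in>UNIV. lam j) = emp_tr n X"
  proof -
    have "(\<Sum>j\<in>UNIV. lam j) = (1 / real n) * (\<Sum>i<n. \<Sum>j\<in>UNIV. (X i \<bullet> p j)\<^sup>2)"
      unfolding lam_eq sum_distrib_left[symmetric] by (subst sum.swap) simp
    then show ?thesis
      by (simp add: p_def sum_inner_columns_sq[OF oP] emp_tr_def)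
  qed
  define D where "D = Q ** diag_mat lam ** transpose Q"
  have S_eq: "?S = P ** diag_mat lam ** transpose P"
    using eigenbasis_decomposition[OF oP] eP by (simp add: p_def)
  have inner_D: "A \<bullet> D = (\<Sum>j\<in>UNIV. lam j * (q j \<bullet> (A *v q j)))" for A
    unfolding D_def conj_diag_mat inner_sum_right inner_scaleR_right inner_outer q_def ..
  have inner_S: "A \<bullet> ?S = (\<Sum>j\<in>UNIV. lam j * (p j \<bullet> (A *v p j)))" for A
    unfolding S_eq conj_diag_mat inner_sum_right inner_scaleR_right inner_outer p_def ..
  have "?B \<bullet> D = (\<Sum>j\<in>UNIV. lam j * mu j)"
    unfolding inner_D by (rule sum.cong) (use nq in \<open>auto simp: eQ norm_eq_1\<close>)
  \<comment> \<open>Expanding each \<open>p j\<close> in the eigenbasis of \<open>?B\<close> gives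
    the weights \<open>(p j \<bullet> q k)\<^sup>2\<close>, which are doubly stochastic by Parseval
    in either basis.\<close>
  moreover have "?B \<bullet> ?S \<le> (\<Sum>j\<in>UNIV. lam j * mu j)"
  proof -
    have "?B \<bullet> ?S = (\<Sum>j\<in>UNIV. \<Sum>k\<in>UNIV. lam j * mu k * (p j \<bullet> q k)\<^sup>2)"
      unfolding inner_S q_def quadform_eigenbasis[OF oQ eQ[unfolded q_def]]
      by (simp add: sum_distrib_left mult_ac)
    also have "\<dots> \<le> (\<Sum>j\<in>UNIV. lam j * mu j)"
    proof (rule doubly_stochastic_rearrangement)
      show "(\<Sum>k\<in>UNIV. (p j \<bullet> q k)\<^sup>2) = 1" for j
        using sum_inner_columns_sq[OF oQ, of "p j"] np[of j] by (simp add: q_def)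
      show "(\<Sum>j\<in>UNIV. (p j \<bullet> q k)\<^sup>2) = 1" for k
        using sum_inner_columns_sq[OF oP, of "q k"] nq[of k] by (simp add: p_def inner_commute)
    qed (use mono_lam mono_mu in auto)
    finally show ?thesis .
  qed
  ultimately have "?B \<bullet> ?S \<le> ?B \<bullet> D" by simp
  then have 1: "?S \<bullet> ?S - ?S \<bullet> D \<le> c * (W \<bullet> D - W \<bullet> ?S)"
    by (simp add: inner_add_left algebra_simps)
  \<comment> \<open>Only quadratic forms of \<open>W\<close> at unit vectors remain, each at most
    \<open>T\<close> in modulus, with nonnegative weights summing to the trace.\<close>
  have "W \<bullet> D - W \<bullet> ?S = (\<Sum>j\<in>UNIV. lam j * (q j \<bullet> (W *v q j) - p j \<bullet> (W *v p j)))"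
    unfolding inner_D inner_S by (simp add: sum_subtractf right_diff_distrib)
  also have "\<dots> \<le> (\<Sum>j\<in>UNIV. lam j * (2 * T))"
    using T[OF nq] T[OF np] by (intro sum_mono mult_left_mono lam0) (smt (verit))
  also have "\<dots> = 2 * T * emp_tr n X"
    by (simp add: sum_distrib_right[symmetric] tr)
  finally have 2: "W \<bullet> D - W \<bullet> ?S \<le> 2 * T * emp_tr n X" .
  \<comment> \<open>\<open>D\<close> and \<open>?S\<close> carry the same diagonal, so their norms
    agree and the square becomes linear in \<open>D\<close>.\<close>
  have "(norm (D - ?S))\<^sup>2 = (norm D)\<^sup>2 + (norm ?S)\<^sup>2 - 2 * (?S \<bullet> D)"
    by (simp add: power2_norm_eq_inner inner_diff_left inner_diff_right inner_commute)
  also have "(norm D)\<^sup>2 = (norm ?S)\<^sup>2"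
    unfolding D_def S_eq norm_conj_diag_mat_sq[OF oP] norm_conj_diag_mat_sq[OF oQ] ..
  finally have "(norm (D - ?S))\<^sup>2 = 2 * (?S \<bullet> ?S - ?S \<bullet> D)"
    by (simp add: power2_norm_eq_inner)
  also have "\<dots> \<le> 2 * (c * (2 * T * emp_tr n X))"
    using 1 mult_left_mono[OF 2 c] by simp
  also have "\<dots> = 4 * (c * T * emp_tr n X)" by simp
  finally have "norm (D - ?S) \<le> sqrt (4 * (c * T * emp_tr n X))"
    by (rule real_le_rsqrt)
  also have "\<dots> = 2 * sqrt (c * T * emp_tr n X)" by (simp only: real_sqrt_mult real_sqrt_four)
  finally have A: "norm (D - ?S) \<le> 2 * sqrt (c * T * emp_tr n X)" .
  \<comment> \<open>The eigenvalue noise enters additively in the basis \<open>Q\<close>, and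
    orthogonal invariance gives its Frobenius norm exactly.\<close>
  define Z where "Z = Q ** diag_mat (\<lambda>j. c * Y j) ** transpose Q"
  have "(norm Z)\<^sup>2 = c\<^sup>2 * (\<Sum>j\<in>UNIV. (Y j)\<^sup>2)"
    unfolding Z_def norm_conj_diag_mat_sq[OF oQ] by (simp add: power_mult_distrib sum_distrib_left)
  then have Z: "norm Z = c * sqrt (\<Sum>j\<in>UNIV. (Y j)\<^sup>2)"
    using c by (metis norm_ge_zero real_sqrt_mult real_sqrt_abs abs_of_nonneg)
  have "Q ** diag_mat (\<lambda>j. lam j + c * Y j) ** transpose Q = D + Z"
    unfolding D_def Z_def conj_diag_mat by (simp add: scaleR_left_distrib sum.distrib)
  then have "norm (Q ** diag_mat (\<lambda>j. lam j + c * Y j) ** transpose Q - ?S) \<le> norm (D - ?S) + norm Z"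
    using norm_triangle_ineq[of "D - ?S" Z] by (simp add: algebra_simps)
  then show ?thesis using A Z by simp
qed

section \<open>Gaussian integration by parts\<close>

abbreviation std_gauss :: "real measure" where
  "std_gauss \<equiv> density lborel std_normal_density"

abbreviation gauss_PiM :: "('i \<Rightarrow> real) measure" where
  "gauss_PiM \<equiv> PiM UNIV (\<lambda>_. std_gauss)"

lemma prob_space_gauss_PiM: "prob_space gauss_PiM"
  by (intro prob_space_PiM prob_space_normal_density) simp

lemma integrable_std_gauss_abs: "integrable std_gauss (\<lambda>x. \<bar>x\<bar>)"
  using integrable_std_normal_moment_abs[of 1]
  by (subst integrable_density) (auto simp: mult_ac)

lemma gauss_PiM_component_abs: "integrable gauss_PiM (\<lambda>w. \<bar>w i\<bar>)"
proof -
  have "distr gauss_PiM std_gauss (\<lambda>w. w i) = std_gauss"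
    by (rule distr_PiM_component) (auto intro: prob_space_normal_density)
  then have "integrable (distr gauss_PiM std_gauss (\<lambda>w. w i)) (\<lambda>x. \<bar>x\<bar>)"
    using integrable_std_gauss_abs by simp
  then show ?thesis
    by (subst (asm) integrable_distr_eq) auto
qed

lemma measurable_gauss_PiM_component [measurable]:
  "(\<lambda>w. w i) \<in> borel_measurable gauss_PiM"
  using measurable_component_singleton[of i UNIV "\<lambda>_. std_gauss"] by simp

text \<open>The density satisfies \<open>n' x = - x * n x\<close>, so
  \<open>n x * F' x - n x * (x * F x)\<close> is the derivative of \<open>F x * n x\<close>. This
  vanishes at both infinities as \<open>F\<close> is bounded, so its integral over the line is
  zero.\<close>

lemma stein_std_gauss:
  fixes F F' :: "real \<Rightarrow> real"
  assumes F: "\<And>x. (F has_real_derivative F' x) (at x)" and cont: "\<And>x. isCont F' x"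
    and bound: "\<And>x. \<bar>F x\<bar> \<le> C" and bound': "\<And>x. \<bar>F' x\<bar> \<le> C'"
  shows "(\<integral>x. x * F x \<partial>std_gauss) = (\<integral>x. F' x \<partial>std_gauss)"
proof -
  have contF: "continuous_on UNIV F"
    using F DERIV_isCont continuous_at_imp_continuous_on by blast
  have [measurable]: "F \<in> borel_measurable borel" "F' \<in> borel_measurable borel"
    using contF cont by (auto intro: borel_measurable_continuous_onI continuous_at_imp_continuous_on)
  let ?n = std_normal_density
  have I1: "integrable lborel (\<lambda>x. ?n x * F' x)"
  proof (rule Bochner_Integration.integrable_bound)
    show "integrable lborel (\<lambda>x. C' * ?n x)"
      using integrable_std_normal_moment[of 0] by simp
    show "AE x in lborel. norm (?n x * F' x) \<le> norm (C' * ?n x)"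
      using bound' order_trans[OF abs_ge_zero bound'] by (auto simp: abs_mult mult.commute intro!: mult_right_mono)
  qed simp
  have I2: "integrable lborel (\<lambda>x. ?n x * (x * F x))"
  proof (rule Bochner_Integration.integrable_bound)
    show "integrable lborel (\<lambda>x. C * (?n x * \<bar>x\<bar>))"
      using integrable_std_normal_moment_abs[of 1] by simp
    have "\<bar>x\<bar> * \<bar>F x\<bar> * ?n x \<le> C * (\<bar>x\<bar> * ?n x)" for x
      using mult_right_mono[OF bound, of "\<bar>x\<bar> * ?n x" x] by (simp add: mult_ac)
    then show "AE x in lborel. norm (?n x * (x * F x)) \<le> norm (C * (?n x * \<bar>x\<bar>))"
      using order_trans[OF abs_ge_zero bound] by (auto simp: abs_mult mult_ac)
  qed simp
  have dn: "(?n has_real_derivative - x * ?n x) (at x)" for x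
  proof -
    have "((\<lambda>x. c * exp (- x\<^sup>2 / 2)) has_real_derivative - x * (c * exp (- x\<^sup>2 / 2))) (at x)" for c :: real
      by (auto intro!: derivative_eq_intros)
    then show ?thesis unfolding std_normal_density_def[abs_def] .
  qed
  have lim_n: "(?n \<longlongrightarrow> 0) at_top" "(?n \<longlongrightarrow> 0) at_bot"
  proof -
    show "(?n \<longlongrightarrow> 0) at_top" unfolding std_normal_density_def[abs_def] by real_asymp
    show "(?n \<longlongrightarrow> 0) at_bot" unfolding std_normal_density_def[abs_def] by real_asymp
  qed
  have lim: "((\<lambda>x. F x * ?n x) \<longlongrightarrow> 0) f" if "(?n \<longlongrightarrow> 0) f" for f
  proof (rule Lim_null_comparison)
    show "\<forall>\<^sub>F x in f. norm (F x * ?n x) \<le> C * ?n x"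
      using bound by (auto simp: abs_mult intro!: mult_right_mono always_eventually)
    show "((\<lambda>x. C * ?n x) \<longlongrightarrow> 0) f"
      using tendsto_mult_right_zero[OF that] by simp
  qed
  have "(LBINT x=-\<infinity>..\<infinity>. ?n x * F' x - ?n x * (x * F x)) = 0 - 0"
  proof (rule interval_integral_FTC_integrable[where F="\<lambda>x. F x * ?n x"])
    fix x :: real
    show "((\<lambda>x. F x * ?n x) has_vector_derivative ?n x * F' x - ?n x * (x * F x)) (at x)"
      unfolding has_real_derivative_iff_has_vector_derivative[symmetric]
      by (rule derivative_eq_intros F dn refl | simp add: algebra_simps)+
    show "isCont (\<lambda>x. ?n x * F' x - ?n x * (x * F x)) x"
      using DERIV_isCont[OF dn] DERIV_isCont[OF F] cont by (intro continuous_intros) auto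
  next
    show "set_integrable lborel (einterval (- \<infinity>) \<infinity>) (\<lambda>x. ?n x * F' x - ?n x * (x * F x))"
      unfolding set_integrable_def using I1 I2 by simp
  next
    show "(((\<lambda>x. F x * ?n x) \<circ> real_of_ereal) \<longlongrightarrow> 0) (at_right (- \<infinity>))"
      unfolding ereal_tendsto_simps by (rule lim lim_n)+
    show "(((\<lambda>x. F x * ?n x) \<circ> real_of_ereal) \<longlongrightarrow> 0) (at_left \<infinity>)"
      unfolding ereal_tendsto_simps by (rule lim lim_n)+
  qed simp
  then have "(\<integral>x. ?n x * F' x - ?n x * (x * F x) \<partial>lborel) = 0"
    by (simp add: interval_lebesgue_integral_def set_lebesgue_integral_def)
  then have "(\<integral>x. ?n x * F' x \<partial>lborel) = (\<integral>x. ?n x * (x * F x) \<partial>lborel)"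
    using I1 I2 by (simp add: Bochner_Integration.integral_diff)
  then show ?thesis
    by (simp add: integral_density)
qed

text \<open>Fubini isolates coordinate \<open>i\<close>, and the one-dimensional identity is applied
  on every line parallel to it.\<close>

lemma stein_gauss_PiM:
  fixes F F' :: "('i::finite \<Rightarrow> real) \<Rightarrow> real"
  assumes [measurable]: "F \<in> borel_measurable gauss_PiM" "F' \<in> borel_measurable gauss_PiM"
    and F: "\<And>w x. ((\<lambda>x. F (w(i := x))) has_real_derivative F' (w(i := x))) (at x)"
    and cont: "\<And>w x. isCont (\<lambda>x. F' (w(i := x))) x"
    and bound: "\<And>w. \<bar>F w\<bar> \<le> C" and bound': "\<And>w. \<bar>F' w\<bar> \<le> C'"
  shows "(\<integral>w. w i * F w \<partial>gauss_PiM) = (\<integral>w. F' w \<partial>gauss_PiM)"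
proof -
  interpret prob_space "gauss_PiM :: ('i \<Rightarrow> real) measure" by (rule prob_space_gauss_PiM)
  interpret G: prob_space std_gauss by (rule prob_space_normal_density) simp
  interpret product_sigma_finite "\<lambda>_::'i. std_gauss" by standard
  have U: "insert i (UNIV - {i}) = UNIV" by auto
  have I1: "integrable gauss_PiM (\<lambda>w. w i * F w)"
  proof (rule Bochner_Integration.integrable_bound)
    show "integrable gauss_PiM (\<lambda>w. C * \<bar>w i\<bar>)"
      using gauss_PiM_component_abs[of i] by simp
    show "AE w in gauss_PiM. norm (w i * F w) \<le> norm (C * \<bar>w i\<bar>)"
    proof (rule AE_I2)
      fix w :: "'i \<Rightarrow> real"
      show "norm (w i * F w) \<le> norm (C * \<bar>w i\<bar>)"
        using mult_right_mono[OF bound, of "\<bar>w i\<bar>" w] order_trans[OF abs_ge_zero bound[of w]]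
        by (simp add: abs_mult mult.commute)
    qed
  qed simp
  have I2: "integrable gauss_PiM F'"
    using bound' by (intro integrable_const_bound[of _ C']) auto
  have "(\<integral>w. w i * F w \<partial>gauss_PiM)
      = (\<integral>w. (\<integral>x. x * F (w(i := x)) \<partial>std_gauss) \<partial>PiM (UNIV - {i}) (\<lambda>_. std_gauss))"
    using product_integral_insert[of "UNIV - {i}" i "\<lambda>w. w i * F w", unfolded U, OF _ _ I1] by simp
  also have "\<dots> = (\<integral>w. (\<integral>x. F' (w(i := x)) \<partial>std_gauss) \<partial>PiM (UNIV - {i}) (\<lambda>_. std_gauss))"
    by (intro Bochner_Integration.integral_cong refl stein_std_gauss[OF F cont bound bound'])
  also have "\<dots> = (\<integral>w. F' w \<partial>gauss_PiM)"
    using product_integral_insert[of "UNIV - {i}" i F', unfolded U, OF _ _ I2] by simp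
  finally show ?thesis .
qed

text \<open>By the mean value theorem the difference quotients are dominated by the same
  \<open>w\<close> as the derivative, so dominated convergence applies along every sequence
  approaching \<open>t\<close>.\<close>

lemma (in finite_measure) DERIV_integral_dominated:
  fixes f f' :: "real \<Rightarrow> 'a \<Rightarrow> real"
  assumes int: "\<And>t. integrable M (f t)" and [measurable]: "\<And>t. f' t \<in> borel_measurable M"
    and der: "\<And>t x. ((\<lambda>t. f t x) has_real_derivative f' t x) (at t)"
    and bound: "\<And>t x. \<bar>f' t x\<bar> \<le> w x" and w: "integrable M w"
  shows "((\<lambda>t. \<integral>x. f t x \<partial>M) has_real_derivative (\<integral>x. f' t x \<partial>M)) (at t)"
  unfolding has_field_derivative_iff tendsto_at_iff_sequentially
proof (intro allI impI)
  fix X :: "nat \<Rightarrow> real" assume X: "\<forall>i. X i \<in> UNIV - {t}" "X \<longlonglongrightarrow> t"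
  have meas [measurable]: "f s \<in> borel_measurable M" for s
    using int[of s] by simp
  have "(\<lambda>i. \<integral>x. (f (X i) x - f t x) / (X i - t) \<partial>M) \<longlonglongrightarrow> (\<integral>x. f' t x \<partial>M)"
  proof (rule integral_dominated_convergence[OF _ _ w])
    show "AE x in M. (\<lambda>i. (f (X i) x - f t x) / (X i - t)) \<longlonglongrightarrow> f' t x"
      using der X unfolding has_field_derivative_iff tendsto_at_iff_sequentially comp_def by blast
    show "AE x in M. norm ((f (X i) x - f t x) / (X i - t)) \<le> w x" for i
    proof (rule AE_I2)
      fix x
      have "norm (f (X i) x - f t x) \<le> w x * norm (X i - t)"
        using bound by (intro field_differentiable_bound[of UNIV "\<lambda>t. f t x" "\<lambda>t. f' t x"])
          (auto intro: der)
      then show "norm ((f (X i) x - f t x) / (X i - t)) \<le> w x"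
        using X by (simp add: divide_simps)
    qed
  qed simp_all
  then show "((\<lambda>s. (integral\<^sup>L M (f s) - integral\<^sup>L M (f t)) / (s - t)) \<circ> X) \<longlonglongrightarrow> (\<integral>x. f' t x \<partial>M)"
    using int by (simp add: comp_def)
qed

section \<open>Slepian's inequality\<close>

text \<open>Jointly Gaussian centred families are encoded by coefficient vectors: the covariance of
  two forms is the dot product of their coefficients, and orthogonal coefficients mean
  independence.\<close>

definition lin_form :: "('i::finite \<Rightarrow> real) \<Rightarrow> ('i \<Rightarrow> real) \<Rightarrow> real" where
  "lin_form c w = (\<Sum>i\<in>UNIV. c i * w i)"

lemma measurable_lin_form [measurable]: "lin_form c \<in> borel_measurable gauss_PiM"
  unfolding lin_form_def[abs_def] by simp

lemma lin_form_upd: "lin_form c (w(i := x)) = c i * x + (\<Sum>j\<in>UNIV - {i}. c j * w j)"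
  unfolding lin_form_def by (subst sum.remove[of _ i]) (auto intro: sum.cong)

lemma DERIV_lin_form_upd: "((\<lambda>x. lin_form c (w(i := x))) has_real_derivative c i) (at x)"
  unfolding lin_form_upd by (auto intro!: derivative_eq_intros)

text \<open>Gaussian interpolation: rotate from the family \<open>a\<close> to the family
  \<open>b\<close> and differentiate the expectation in the angle. Integration by parts expresses
  the derivative through differences of covariances times expectations of known sign.\<close>

lemma slepian_smooth:
  fixes a b :: "'n \<Rightarrow> 'i::finite \<Rightarrow> real" and h h' h'' :: "real \<Rightarrow> real"
  assumes N: "finite N"
    and orth: "\<And>u v. u \<in> N \<Longrightarrow> v \<in> N \<Longrightarrow> (\<Sum>i\<in>UNIV. a u i * b v i) = 0"
    and var: "\<And>u. u \<in> N \<Longrightarrow> (\<Sum>i\<in>UNIV. b u i * b u i) = (\<Sum>i\<in>UNIV. a u i * a u i)"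
    and cov: "\<And>u v. u \<in> N \<Longrightarrow> v \<in> N \<Longrightarrow> (\<Sum>i\<in>UNIV. b u i * b v i) \<le> (\<Sum>i\<in>UNIV. a u i * a v i)"
    and h: "\<And>x. (h has_real_derivative h' x) (at x)" and h': "\<And>x. (h' has_real_derivative h'' x) (at x)"
    and h'': "\<And>x. isCont h'' x"
    and h01: "\<And>x. 0 \<le> h x" "\<And>x. h x \<le> 1"
    and h'_bound: "\<And>x. h' x \<le> 0" "\<And>x. \<bar>h' x\<bar> \<le> K" and h''_bound: "\<And>x. \<bar>h'' x\<bar> \<le> K"
  shows "(\<integral>w. (\<Prod>u\<in>N. h (lin_form (b u) w)) \<partial>gauss_PiM) \<le> (\<integral>w. (\<Prod>u\<in>N. h (lin_form (a u) w)) \<partial>gauss_PiM)"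
proof -
  interpret prob_space "gauss_PiM :: ('i \<Rightarrow> real) measure" by (rule prob_space_gauss_PiM)
  have [measurable]: "h \<in> borel_measurable borel" "h' \<in> borel_measurable borel" "h'' \<in> borel_measurable borel"
    using DERIV_isCont[OF h] DERIV_isCont[OF h'] h''
    by (auto intro!: borel_measurable_continuous_onI continuous_at_imp_continuous_on)
  \<comment> \<open>The rotation equals \<open>a\<close> at angle 0 and \<open>b\<close> at angle
    \<open>pi / 2\<close>; \<open>c'\<close> is its derivative in \<open>t\<close>.\<close>
  define c where "c t u i = cos t * a u i + sin t * b u i" for t u i
  define c' where "c' t u i = - sin t * a u i + cos t * b u i" for t u i
  define f where "f t w = (\<Prod>u\<in>N. h (lin_form (c t u) w))" for t w
  define F where "F t u w = h' (lin_form (c t u) w) * (\<Prod>v\<in>N - {u}. h (lin_form (c t v) w))" for t u w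
  define D where "D t w = (\<Sum>u\<in>N. lin_form (c' t u) w * F t u w)" for t w
  have prod01: "0 \<le> (\<Prod>v\<in>M. h (g v))" "(\<Prod>v\<in>M. h (g v)) \<le> 1" for M and g :: "'n \<Rightarrow> real"
    using h01 by (auto intro!: prod_nonneg prod_le_1)
  have K0: "0 \<le> K" using order_trans[OF abs_ge_zero h'_bound(2)] .
  have f_abs: "\<bar>f t w\<bar> \<le> 1" for t w
    unfolding f_def using prod01 by (simp add: abs_of_nonneg)
  have F_abs: "\<bar>F t u w\<bar> \<le> K" for t u w
  proof -
    have "\<bar>F t u w\<bar> \<le> K * 1"
      unfolding F_def abs_mult by (intro mult_mono h'_bound) (use prod01 K0 in \<open>auto simp: abs_of_nonneg\<close>)
    then show ?thesis by simp
  qed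
  have [measurable]: "f t \<in> borel_measurable gauss_PiM" "F t u \<in> borel_measurable gauss_PiM"
      "D t \<in> borel_measurable gauss_PiM" for t u
    unfolding f_def[abs_def] F_def[abs_def] D_def[abs_def] by measurable
  \<comment> \<open>An integrable envelope for \<open>D\<close>, uniform in \<open>t\<close>: sine
    and cosine are replaced by 1 and the cutoff factors by \<open>K\<close>.\<close>
  define wt where "wt w = (\<Sum>u\<in>N. (\<Sum>i\<in>UNIV. (\<bar>a u i\<bar> + \<bar>b u i\<bar>) * \<bar>w i\<bar>) * K)" for w :: "'i \<Rightarrow> real"
  have wt_int: "integrable gauss_PiM wt"
    unfolding wt_def[abs_def]
    by (intro integrable_mult_left integrable_mult_right Bochner_Integration.integrable_sum
        gauss_PiM_component_abs)
  have D_abs: "\<bar>D t w\<bar> \<le> wt w" for t w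
  proof -
    have c'_abs: "\<bar>c' t u i\<bar> \<le> \<bar>a u i\<bar> + \<bar>b u i\<bar>" for u i
    proof -
      have "\<bar>c' t u i\<bar> \<le> \<bar>sin t\<bar> * \<bar>a u i\<bar> + \<bar>cos t\<bar> * \<bar>b u i\<bar>"
        unfolding c'_def by (rule order_trans[OF abs_triangle_ineq]) (simp add: abs_mult)
      also have "\<dots> \<le> 1 * \<bar>a u i\<bar> + 1 * \<bar>b u i\<bar>"
        by (intro add_mono mult_right_mono) auto
      finally show ?thesis by simp
    qed
    have "\<bar>lin_form (c' t u) w\<bar> \<le> (\<Sum>i\<in>UNIV. (\<bar>a u i\<bar> + \<bar>b u i\<bar>) * \<bar>w i\<bar>)" for u
      unfolding lin_form_def
      by (rule order_trans[OF sum_abs]) (auto simp: abs_mult intro!: sum_mono mult_right_mono c'_abs)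
    then show ?thesis
      unfolding D_def wt_def
      by (intro order_trans[OF sum_abs] sum_mono) (auto simp: abs_mult intro!: mult_mono F_abs sum_nonneg)
  qed
  have f_der: "((\<lambda>t. f t w) has_real_derivative D t w) (at t)" for t w
  proof -
    have "((\<lambda>t. lin_form (c t u) w) has_real_derivative lin_form (c' t u) w) (at t)" for u
      unfolding lin_form_def c_def c'_def
      by (auto intro!: derivative_eq_intros sum.cong simp: algebra_simps)
    then have "((\<lambda>t. h (lin_form (c t u) w)) has_real_derivative
        h' (lin_form (c t u) w) * lin_form (c' t u) w) (at t)" for u
      by (rule DERIV_chain2[OF h])
    then have "((\<lambda>t. f t w) has_real_derivative
        (\<Sum>u\<in>N. h' (lin_form (c t u) w) * lin_form (c' t u) w * (\<Prod>v\<in>N - {u}. h (lin_form (c t v) w)))) (at t)"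
      unfolding f_def by (intro has_field_derivative_prod) auto
    then show ?thesis
      unfolding D_def F_def by (simp add: mult_ac)
  qed
  have der: "((\<lambda>t. \<integral>w. f t w \<partial>gauss_PiM) has_real_derivative (\<integral>w. D t w \<partial>gauss_PiM)) (at t)" for t
    by (rule DERIV_integral_dominated[OF _ _ f_der D_abs wt_int])
      (use f_abs in \<open>auto intro: integrable_const_bound[of _ 1]\<close>)
  \<comment> \<open>On this range of angles \<open>sin t * cos t\<close> is nonnegative, which fixes
    the sign of the covariances of \<open>c'\<close> with \<open>c\<close>.\<close>
  have D_nonpos: "(\<integral>w. D t w \<partial>gauss_PiM) \<le> 0" if t: "0 \<le> t" "t \<le> pi / 2" for t
  proof -
    \<comment> \<open>Differentiating \<open>F t u\<close> along a coordinate hits either its own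
      factor, giving \<open>A u\<close>, or another factor \<open>v\<close>, giving
      \<open>R u v\<close>. The latter contains two nonpositive factors \<open>h'\<close>, hence
      \<open>R u v \<ge> 0\<close>.\<close>
    define A where "A u = (\<integral>w. h'' (lin_form (c t u) w) * (\<Prod>v\<in>N - {u}. h (lin_form (c t v) w)) \<partial>gauss_PiM)" for u
    define r where "r u v w = h' (lin_form (c t u) w) * (h' (lin_form (c t v) w)
        * (\<Prod>x\<in>N - {u} - {v}. h (lin_form (c t x) w)))" for u v w
    define R where "R u v = (\<integral>w. r u v w \<partial>gauss_PiM)" for u v
    have abs1: "\<bar>h'' (lin_form (c t u) w) * (\<Prod>v\<in>N - {u}. h (lin_form (c t v) w))\<bar> \<le> K" for u w
    proof -
      have "\<bar>h'' (lin_form (c t u) w) * (\<Prod>v\<in>N - {u}. h (lin_form (c t v) w))\<bar> \<le> K * 1"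
        unfolding abs_mult by (intro mult_mono h''_bound) (use prod01 K0 in \<open>auto simp: abs_of_nonneg\<close>)
      then show ?thesis by simp
    qed
    have abs2: "\<bar>r u v w\<bar> \<le> K * (K * 1)" for u v w
      unfolding r_def abs_mult
      by (intro mult_mono h'_bound) (use prod01 K0 in \<open>auto simp: abs_of_nonneg\<close>)
    have [measurable]: "r u v \<in> borel_measurable gauss_PiM" for u v
      unfolding r_def[abs_def] by measurable
    have int1: "integrable gauss_PiM (\<lambda>w. h'' (lin_form (c t u) w) * (\<Prod>v\<in>N - {u}. h (lin_form (c t v) w)))" for u
      by (rule integrable_const_bound[of _ K]) (use abs1 in auto)
    have int2: "integrable gauss_PiM (r u v)" for u v
      by (rule integrable_const_bound[of _ "K * (K * 1)"]) (use abs2 in auto)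
    have R_nonneg: "0 \<le> R u v" for u v
      unfolding R_def r_def
      by (intro integral_nonneg_AE AE_I2) (use h'_bound(1) prod01 in \<open>auto intro!: mult_nonpos_nonpos mult_nonpos_nonneg\<close>)
    have ibp: "(\<integral>w. w i * F t u w \<partial>gauss_PiM) = c t u i * A u + (\<Sum>v\<in>N - {u}. c t v i * R u v)" for u i
    proof -
      define F' where "F' w = c t u i * (h'' (lin_form (c t u) w) * (\<Prod>v\<in>N - {u}. h (lin_form (c t v) w)))
          + (\<Sum>v\<in>N - {u}. c t v i * r u v w)" for w
      have "(\<integral>w. w i * F t u w \<partial>gauss_PiM) = (\<integral>w. F' w \<partial>gauss_PiM)"
      proof (rule stein_gauss_PiM[OF _ _ _ _ F_abs])
        show "F' \<in> borel_measurable gauss_PiM" unfolding F'_def[abs_def] by measurable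
        fix w x
        have Z: "((\<lambda>x. h (lin_form (c t v) (w(i := x)))) has_real_derivative
            h' (lin_form (c t v) (w(i := x))) * c t v i) (at x)" for v
          by (rule DERIV_chain2[OF h DERIV_lin_form_upd])
        have Z': "((\<lambda>x. h' (lin_form (c t u) (w(i := x)))) has_real_derivative
            h'' (lin_form (c t u) (w(i := x))) * c t u i) (at x)"
          by (rule DERIV_chain2[OF h' DERIV_lin_form_upd])
        show "((\<lambda>x. F t u (w(i := x))) has_real_derivative F' (w(i := x))) (at x)"
          unfolding F_def F'_def r_def
          by (rule DERIV_cong[OF DERIV_mult[OF Z' has_field_derivative_prod[OF Z]]])
            (simp add: sum_distrib_left mult_ac)
        have cl: "isCont (\<lambda>x. lin_form (c t v) (w(i := x))) x" for v
          using DERIV_lin_form_upd by (rule DERIV_isCont)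
        have cc: "isCont (\<lambda>x. h (lin_form (c t v) (w(i := x)))) x"
          "isCont (\<lambda>x. h' (lin_form (c t v) (w(i := x)))) x"
          "isCont (\<lambda>x. h'' (lin_form (c t v) (w(i := x)))) x" for v
          using isCont_o2[OF cl] DERIV_isCont[OF h] DERIV_isCont[OF h'] h'' by blast+
        show "isCont (\<lambda>x. F' (w(i := x))) x"
          unfolding F'_def r_def by (intro continuous_intros cc)
      next
        fix w
        have "\<bar>F' w\<bar> \<le> \<bar>c t u i\<bar> * K + (\<Sum>v\<in>N - {u}. \<bar>c t v i\<bar> * (K * (K * 1)))"
          unfolding F'_def
          by (intro order_trans[OF abs_triangle_ineq] add_mono order_trans[OF sum_abs] sum_mono)
            (auto simp only: abs_mult[of "c _ _ _"] intro!: mult_left_mono abs1 abs2 abs_ge_zero)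
        then show "\<bar>F' w\<bar> \<le> \<bar>c t u i\<bar> * K + (\<Sum>v\<in>N - {u}. \<bar>c t v i\<bar> * (K * (K * 1)))" .
      qed simp
      also have "\<dots> = c t u i * A u + (\<Sum>v\<in>N - {u}. c t v i * R u v)"
        unfolding F'_def A_def R_def using int1 int2 by simp
      finally show ?thesis .
    qed
    have intF: "integrable gauss_PiM (\<lambda>w. w i * F t u w)" for i u
    proof (rule Bochner_Integration.integrable_bound)
      show "integrable gauss_PiM (\<lambda>w. K * \<bar>w i\<bar>)"
        using gauss_PiM_component_abs[of i] by simp
      show "AE w in gauss_PiM. norm (w i * F t u w) \<le> norm (K * \<bar>w i\<bar>)"
      proof (rule AE_I2)
        fix w :: "'i \<Rightarrow> real"
        show "norm (w i * F t u w) \<le> norm (K * \<bar>w i\<bar>)"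
          using mult_right_mono[OF F_abs, of "\<bar>w i\<bar>" t u w] K0
          by (simp add: abs_mult mult.commute)
      qed
    qed simp
    \<comment> \<open>Orthogonality of the two families removes the terms with
      \<open>(cos t)\<^sup>2\<close> and \<open>(sin t)\<^sup>2\<close>.\<close>
    have cc: "(\<Sum>i\<in>UNIV. c' t u i * c t v i)
        = sin t * cos t * ((\<Sum>i\<in>UNIV. b u i * b v i) - (\<Sum>i\<in>UNIV. a u i * a v i))"
      if "u \<in> N" "v \<in> N" for u v
    proof -
      have "(\<Sum>i\<in>UNIV. c' t u i * c t v i)
        = sin t * cos t * ((\<Sum>i\<in>UNIV. b u i * b v i) - (\<Sum>i\<in>UNIV. a u i * a v i))
          + (cos t)\<^sup>2 * (\<Sum>i\<in>UNIV. a v i * b u i) - (sin t)\<^sup>2 * (\<Sum>i\<in>UNIV. a u i * b v i)"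
        unfolding sum_distrib_left sum_subtractf[symmetric] sum.distrib[symmetric] c_def c'_def
        by (intro sum.cong refl) (simp add: algebra_simps power2_eq_square)
      then show ?thesis using orth that by simp
    qed
    have sc: "0 \<le> sin t * cos t"
      using t by (intro mult_nonneg_nonneg sin_ge_zero cos_ge_zero) auto
    have "(\<integral>w. D t w \<partial>gauss_PiM) = (\<integral>w. (\<Sum>u\<in>N. \<Sum>i\<in>UNIV. c' t u i * (w i * F t u w)) \<partial>gauss_PiM)"
      unfolding D_def lin_form_def sum_distrib_right by (simp add: mult_ac)
    also have "\<dots> = (\<Sum>u\<in>N. \<Sum>i\<in>UNIV. c' t u i * (\<integral>w. w i * F t u w \<partial>gauss_PiM))"
      using intF by simp
    also have "\<dots> = (\<Sum>u\<in>N. (\<Sum>i\<in>UNIV. c' t u i * c t u i) * A u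
        + (\<Sum>v\<in>N - {u}. (\<Sum>i\<in>UNIV. c' t u i * c t v i) * R u v))"
    proof (intro sum.cong refl)
      fix u
      have "(\<Sum>i\<in>UNIV. \<Sum>v\<in>N - {u}. c' t u i * (c t v i * R u v))
          = (\<Sum>v\<in>N - {u}. \<Sum>i\<in>UNIV. c' t u i * (c t v i * R u v))"
        by (rule sum.swap)
      then show "(\<Sum>i\<in>UNIV. c' t u i * (\<integral>w. w i * F t u w \<partial>gauss_PiM))
        = (\<Sum>i\<in>UNIV. c' t u i * c t u i) * A u + (\<Sum>v\<in>N - {u}. (\<Sum>i\<in>UNIV. c' t u i * c t v i) * R u v)"
        unfolding ibp by (simp add: distrib_left sum.distrib sum_distrib_left sum_distrib_right mult.assoc)
    qed
    \<comment> \<open>Equal variances cancel the terms \<open>A u\<close>, whose sign is unknown;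
      the remaining terms are a nonpositive covariance times a nonnegative
      \<open>R u v\<close>.\<close>
    also have "\<dots> \<le> 0"
    proof (rule sum_nonpos)
      fix u assume u: "u \<in> N"
      have "(\<Sum>i\<in>UNIV. c' t u i * c t u i) = 0"
        using cc[OF u u] var[OF u] by simp
      moreover have "(\<Sum>v\<in>N - {u}. (\<Sum>i\<in>UNIV. c' t u i * c t v i) * R u v) \<le> 0"
      proof (rule sum_nonpos)
        fix v assume v: "v \<in> N - {u}"
        then have "(\<Sum>i\<in>UNIV. c' t u i * c t v i) \<le> 0"
          using cc[of u v] u cov[of u v] sc by (simp add: mult_nonneg_nonpos)
        then show "(\<Sum>i\<in>UNIV. c' t u i * c t v i) * R u v \<le> 0"
          by (rule mult_nonpos_nonneg[OF _ R_nonneg])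
      qed
      ultimately show "(\<Sum>i\<in>UNIV. c' t u i * c t u i) * A u
        + (\<Sum>v\<in>N - {u}. (\<Sum>i\<in>UNIV. c' t u i * c t v i) * R u v) \<le> 0" by simp
    qed
    finally show ?thesis .
  qed
  have "(\<integral>w. f (pi / 2) w \<partial>gauss_PiM) \<le> (\<integral>w. f 0 w \<partial>gauss_PiM)"
    by (rule DERIV_nonpos_imp_nonincreasing) (use der D_nonpos in auto)
  then show ?thesis
    unfolding f_def c_def by simp
qed

text \<open>A smooth decreasing cutoff. Steeply rescaled it approximates the indicator of a
  half-line, and its derivatives are polynomials in the function itself, hence bounded.\<close>

definition logistic_dec :: "real \<Rightarrow> real" where
  "logistic_dec x = 1 / (1 + exp x)"

text \<open>The product of steep cutoffs over \<open>N\<close> approximates the indicator that no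
  form exceeds the level, so the smooth comparison passes to the events. The gap between
  \<open>s\<close> and \<open>t\<close> leaves room for the cutoff.\<close>

lemma slepian_tail:
  fixes a b :: "'n \<Rightarrow> 'i::finite \<Rightarrow> real"
  assumes N: "finite N"
    and orth: "\<And>u v. u \<in> N \<Longrightarrow> v \<in> N \<Longrightarrow> (\<Sum>i\<in>UNIV. a u i * b v i) = 0"
    and var: "\<And>u. u \<in> N \<Longrightarrow> (\<Sum>i\<in>UNIV. b u i * b u i) = (\<Sum>i\<in>UNIV. a u i * a u i)"
    and cov: "\<And>u v. u \<in> N \<Longrightarrow> v \<in> N \<Longrightarrow> (\<Sum>i\<in>UNIV. b u i * b v i) \<le> (\<Sum>i\<in>UNIV. a u i * a v i)"
    and st: "s < t"
  shows "measure gauss_PiM {w\<in>space gauss_PiM. \<exists>u\<in>N. t < lin_form (a u) w}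
    \<le> measure gauss_PiM {w\<in>space gauss_PiM. \<exists>u\<in>N. s < lin_form (b u) w}"
    (is "measure _ ?A \<le> measure _ ?B")
proof -
  interpret prob_space "gauss_PiM :: ('i \<Rightarrow> real) measure" by (rule prob_space_gauss_PiM)
  have [measurable]: "?A \<in> sets gauss_PiM" "?B \<in> sets gauss_PiM"
    using N by measurable
  have ind [simp]: "integrable gauss_PiM (indicat_real (space gauss_PiM - ?A))"
    "integrable gauss_PiM (indicat_real (space gauss_PiM - ?B))"
    by (intro integrable_real_indicator sets.compl_sets; simp add: less_top[symmetric])+
  \<comment> \<open>Centring the cutoff at the midpoint makes its value tend to 1 at
    \<open>s\<close> and to 0 at \<open>t\<close> as the steepness \<open>m\<close> grows.\<close>
  define r where "r = (s + t) / 2"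
  let ?g = "\<lambda>m x. logistic_dec (m * (x - r))"
  have g01: "0 < ?g m x" "?g m x < 1" for m x
    by (auto simp: logistic_dec_def add_pos_pos)
  have mono: "?g m y \<le> ?g m x" if "x \<le> y" "0 \<le> m" for m x y
    using that by (auto simp: logistic_dec_def intro!: divide_left_mono add_pos_pos mult_pos_pos mult_left_mono)
  have logistic_der: "(logistic_dec has_real_derivative - logistic_dec x * (1 - logistic_dec x)) (at x)" for x
  proof -
    have "1 + exp x \<noteq> 0" by (smt (verit) exp_gt_zero)
    then show ?thesis unfolding logistic_dec_def[abs_def]
      by (auto intro!: derivative_eq_intros simp: field_simps power2_eq_square)
  qed
  \<comment> \<open>Off \<open>?B\<close> every factor is at least its value at \<open>s\<close>; on
    \<open>?A\<close> some factor is at most its value at \<open>t\<close>, and elsewhere the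
    product is at most 1.\<close>
  have key: "?g m s ^ card N * (1 - prob ?B) \<le> ?g m t + (1 - prob ?A)" if m: "m > 0" for m
  proof -
    let ?h = "?g m"
    let ?h' = "\<lambda>x. - m * (?h x * (1 - ?h x))"
    let ?h'' = "\<lambda>x. m\<^sup>2 * (?h x * (1 - ?h x) * (1 - 2 * ?h x))"
    have dh: "(?h has_real_derivative ?h' x) (at x)" for x
      by (rule DERIV_cong[OF DERIV_chain2[OF logistic_der]]) (auto intro!: derivative_eq_intros)
    have dh': "(?h' has_real_derivative ?h'' x) (at x)" for x
      by (rule derivative_eq_intros dh refl | simp add: algebra_simps power2_eq_square)+
    have b1: "\<bar>?h x * (1 - ?h x)\<bar> \<le> 1" for x
      using g01[of m x] by (auto simp: abs_mult mult_le_one)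
    have b2: "\<bar>?h x * (1 - ?h x) * (1 - 2 * ?h x)\<bar> \<le> 1" for x
      unfolding abs_mult[of _ "1 - 2 * ?h x"] using g01[of m x] b1[of x] by (intro mult_le_one) auto
    have "(\<integral>w. (\<Prod>u\<in>N. ?h (lin_form (b u) w)) \<partial>gauss_PiM) \<le> (\<integral>w. (\<Prod>u\<in>N. ?h (lin_form (a u) w)) \<partial>gauss_PiM)"
    \<comment> \<open>The first derivative is of size \<open>m\<close> and the second of size
      \<open>m\<^sup>2\<close>; the sum bounds both.\<close>
    proof (rule slepian_smooth[OF N orth var cov dh dh', where K="m + m\<^sup>2"])
      fix x
      show "isCont ?h'' x" using DERIV_isCont[OF dh] by (intro continuous_intros)
      show "0 \<le> ?h x" "?h x \<le> 1" using g01[of m x] by auto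
      show "?h' x \<le> 0" using g01[of m x] m by (simp add: mult_nonneg_nonneg)
      have "\<bar>?h' x\<bar> \<le> m * 1" unfolding abs_mult[of "- m"] using m b1[of x] by (intro mult_mono) auto
      then show "\<bar>?h' x\<bar> \<le> m + m\<^sup>2" by (simp add: add_increasing2)
      have "\<bar>?h'' x\<bar> \<le> m\<^sup>2 * 1" unfolding abs_mult[of "m\<^sup>2"] using m b2[of x] by (intro mult_mono) auto
      then show "\<bar>?h'' x\<bar> \<le> m + m\<^sup>2" using m by (simp add: add_increasing)
    qed
    moreover have "?g m s ^ card N * (1 - prob ?B) \<le> (\<integral>w. (\<Prod>u\<in>N. ?h (lin_form (b u) w)) \<partial>gauss_PiM)"
    proof -
      have [measurable]: "?h \<in> borel_measurable borel" unfolding logistic_dec_def[abs_def] by measurable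
      have "?g m s ^ card N * (1 - prob ?B) = ?g m s ^ card N * prob (space gauss_PiM - ?B)"
        by (simp add: prob_compl)
      also have "\<dots> = (\<integral>w. ?g m s ^ card N * indicator (space gauss_PiM - ?B) w \<partial>gauss_PiM)"
        by simp
      also have "\<dots> \<le> (\<integral>w. (\<Prod>u\<in>N. ?h (lin_form (b u) w)) \<partial>gauss_PiM)"
      proof (rule integral_mono)
        show "integrable gauss_PiM (\<lambda>w. \<Prod>u\<in>N. ?h (lin_form (b u) w))"
          using g01 by (intro integrable_const_bound[of _ 1])
            (auto simp: abs_prod less_imp_le abs_of_pos intro!: prod_le_1)
        fix w assume w: "w \<in> space (gauss_PiM :: ('i \<Rightarrow> real) measure)"
        show "?g m s ^ card N * indicator (space gauss_PiM - ?B) w \<le> (\<Prod>u\<in>N. ?h (lin_form (b u) w))"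
        proof (cases "w \<in> ?B")
          case False
          then have "(\<Prod>u\<in>N. ?g m s) \<le> (\<Prod>u\<in>N. ?h (lin_form (b u) w))"
            using w m g01 by (intro prod_mono conjI mono) (auto simp: less_imp_le not_less)
          then show ?thesis using False w by simp
        next
          case True
          then show ?thesis using g01 by (simp add: prod_nonneg less_imp_le)
        qed
      qed simp
      finally show ?thesis .
    qed
    moreover have "(\<integral>w. (\<Prod>u\<in>N. ?h (lin_form (a u) w)) \<partial>gauss_PiM) \<le> ?g m t + (1 - prob ?A)"
    proof -
      have [measurable]: "?h \<in> borel_measurable borel" unfolding logistic_dec_def[abs_def] by measurable
      have "(\<integral>w. (\<Prod>u\<in>N. ?h (lin_form (a u) w)) \<partial>gauss_PiM)
          \<le> (\<integral>w. ?g m t + indicator (space gauss_PiM - ?A) w \<partial>gauss_PiM)"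
      proof (rule integral_mono)
        show "integrable gauss_PiM (\<lambda>w. \<Prod>u\<in>N. ?h (lin_form (a u) w))"
          using g01 by (intro integrable_const_bound[of _ 1])
            (auto simp: abs_prod less_imp_le abs_of_pos intro!: prod_le_1)
        fix w assume w: "w \<in> space (gauss_PiM :: ('i \<Rightarrow> real) measure)"
        show "(\<Prod>u\<in>N. ?h (lin_form (a u) w)) \<le> ?g m t + indicator (space gauss_PiM - ?A) w"
        proof (cases "w \<in> ?A")
          case True
          then obtain v where v: "v \<in> N" "t < lin_form (a v) w" by auto
          have "(\<Prod>u\<in>N. ?h (lin_form (a u) w))
              = ?h (lin_form (a v) w) * (\<Prod>u\<in>N - {v}. ?h (lin_form (a u) w))"
            using N v by (simp add: prod.remove)
          also have "\<dots> \<le> ?g m t * 1"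
            using v m g01 by (intro mult_mono mono prod_le_1) (auto simp: less_imp_le intro: prod_nonneg)
          finally show ?thesis using True by simp
        next
          case False
          have "(\<Prod>u\<in>N. ?h (lin_form (a u) w)) \<le> 1"
            using g01 by (intro prod_le_1) (auto simp: less_imp_le)
          then show ?thesis using False w g01[of m t] by simp
        qed
      qed simp
      also have "\<dots> = ?g m t + (1 - prob ?A)" using prob_space by (simp add: prob_compl)
      finally show ?thesis .
    qed
    ultimately show ?thesis by linarith
  qed
  have lim_s: "((\<lambda>m. ?g m s ^ card N * (1 - prob ?B)) \<longlongrightarrow> 1 ^ card N * (1 - prob ?B)) at_top"
  proof (intro tendsto_intros)
    have "s - r < 0" using st by (simp add: r_def)
    then show "((\<lambda>m. ?g m s) \<longlongrightarrow> 1) at_top" unfolding logistic_dec_def by real_asymp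
  qed
  have lim_t: "((\<lambda>m. ?g m t + (1 - prob ?A)) \<longlongrightarrow> 0 + (1 - prob ?A)) at_top"
  proof (intro tendsto_intros)
    have "t - r > 0" using st by (simp add: r_def)
    then show "((\<lambda>m. ?g m t) \<longlongrightarrow> 0) at_top" unfolding logistic_dec_def by real_asymp
  qed
  have "1 ^ card N * (1 - prob ?B) \<le> 0 + (1 - prob ?A)"
    by (rule tendsto_le[OF _ lim_t lim_s]) (auto intro!: eventually_mono[OF eventually_gt_at_top[of 0]] key)
  then show ?thesis by simp
qed

section \<open>Chi-square tail\<close>

text \<open>Both sides agree at 1, and the difference has derivative
  \<open>- ((1 / x - 1)\<^sup>2 / 2)\<close>. The bound is sharp enough to give the exact exponent
  in the chi-square tail.\<close>

lemma neg_ln_le: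
  fixes y :: real
  assumes "0 < y" "y \<le> 1"
  shows "- ln y \<le> (1 / y - y) / 2"
proof -
  have "(1 / 1 - 1) / 2 + ln 1 \<le> (1 / y - y) / 2 + ln y"
  proof (rule DERIV_nonpos_imp_nonincreasing[OF assms(2)])
    fix x assume x: "y \<le> x" "x \<le> 1"
    have "((\<lambda>x. (1 / x - x) / 2 + ln x) has_real_derivative - ((1 / x - 1)\<^sup>2 / 2)) (at x)"
      using assms x by (auto intro!: derivative_eq_intros simp: field_simps power2_eq_square)
    then show "\<exists>D. ((\<lambda>x. (1 / x - x) / 2 + ln x) has_real_derivative D) (at x) \<and> D \<le> 0"
      by (intro exI[of _ "- ((1 / x - 1)\<^sup>2 / 2)"]) simp
  qed
  then have "0 \<le> (1 / y - y) / 2 + ln y" by simp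
  then show ?thesis by linarith
qed

text \<open>Tilting the standard density by \<open>exp ((1 - y) / 2 * x\<^sup>2)\<close> gives, up
  to the factor \<open>1 / sqrt y\<close>, the centred normal density of variance
  \<open>1 / y\<close>.\<close>

lemma std_gauss_mgf_square:
  assumes "0 < (y::real)"
  shows "integrable std_gauss (\<lambda>x. exp ((1 - y) / 2 * x\<^sup>2))"
    and "(\<integral>x. exp ((1 - y) / 2 * x\<^sup>2) \<partial>std_gauss) = 1 / sqrt y"
proof -
  have eq: "std_normal_density x * exp ((1 - y) / 2 * x\<^sup>2) = 1 / sqrt y * normal_density 0 (1 / sqrt y) x" for x
  proof -
    have "- x\<^sup>2 / 2 + (1 - y) / 2 * x\<^sup>2 = - (x\<^sup>2 * y) / 2" by (simp add: field_simps)
    then have "std_normal_density x * exp ((1 - y) / 2 * x\<^sup>2) = 1 / sqrt (2 * pi) * exp (- (x\<^sup>2 * y) / 2)"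
      unfolding std_normal_density_def by (simp add: exp_add[symmetric])
    also have "\<dots> = 1 / sqrt y * normal_density 0 (1 / sqrt y) x"
      using assms by (simp add: normal_density_def power_divide real_sqrt_mult real_sqrt_divide)
    finally show ?thesis .
  qed
  show "integrable std_gauss (\<lambda>x. exp ((1 - y) / 2 * x\<^sup>2))"
    by (subst integrable_density) (use assms in \<open>auto simp: eq simp del: times_divide_eq_left\<close>)
  have "(\<integral>x. exp ((1 - y) / 2 * x\<^sup>2) \<partial>std_gauss) = (\<integral>x. 1 / sqrt y * normal_density 0 (1 / sqrt y) x \<partial>lborel)"
    by (subst integral_density) (auto simp: eq simp del: times_divide_eq_left)
  also have "\<dots> = 1 / sqrt y * (\<integral>x. normal_density 0 (1 / sqrt y) x \<partial>lborel)"
    by (rule integral_mult_right_zero)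
  also have "\<dots> = 1 / sqrt y" using assms by simp
  finally show "(\<integral>x. exp ((1 - y) / 2 * x\<^sup>2) \<partial>std_gauss) = 1 / sqrt y" .
qed

lemma gauss_PiM_mgf_sum_squares:
  fixes J :: "'i::finite set"
  assumes "0 < (y::real)"
  shows "integrable gauss_PiM (\<lambda>w. exp ((1 - y) / 2 * (\<Sum>i\<in>J. (w i)\<^sup>2)))"
    and "(\<integral>w. exp ((1 - y) / 2 * (\<Sum>i\<in>J. (w i)\<^sup>2)) \<partial>gauss_PiM) = (1 / sqrt y) ^ card J"
proof -
  interpret G: prob_space std_gauss by (rule prob_space_normal_density) simp
  interpret product_sigma_finite "\<lambda>_::'i. std_gauss" by standard
  define f where "f i x = (if i \<in> J then exp ((1 - y) / 2 * x\<^sup>2) else 1)" for i :: 'i and x :: real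
  have eq: "exp ((1 - y) / 2 * (\<Sum>i\<in>J. (w i)\<^sup>2)) = (\<Prod>i\<in>UNIV. f i (w i))" for w
    unfolding f_def by (simp add: sum_distrib_left exp_sum prod.If_cases)
  have int: "integrable std_gauss (f i)" for i
    unfolding f_def using std_gauss_mgf_square(1)[OF assms] by (cases "i \<in> J") auto
  have val: "integral\<^sup>L std_gauss (f i) = (if i \<in> J then 1 / sqrt y else 1)" for i
    unfolding f_def using std_gauss_mgf_square(2)[OF assms] G.prob_space by simp
  show "integrable gauss_PiM (\<lambda>w. exp ((1 - y) / 2 * (\<Sum>i\<in>J. (w i)\<^sup>2)))"
    unfolding eq by (rule product_integrable_prod[OF finite int])
  show "(\<integral>w. exp ((1 - y) / 2 * (\<Sum>i\<in>J. (w i)\<^sup>2)) \<partial>gauss_PiM) = (1 / sqrt y) ^ card J"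
    unfolding eq product_integral_prod[OF finite int] val by (simp add: prod.If_cases)
qed

lemma chi_square_tail:
  fixes J :: "'i::finite set"
  assumes J: "J \<noteq> {}" and L: "0 < L"
  shows "measure gauss_PiM {w\<in>space gauss_PiM. real (card J) + 2 * sqrt (real (card J) * L) + 2 * L \<le> (\<Sum>i\<in>J. (w i)\<^sup>2)}
    \<le> exp (- L)"
proof -
  interpret prob_space "gauss_PiM :: ('i \<Rightarrow> real) measure" by (rule prob_space_gauss_PiM)
  define p where "p = sqrt (real (card J))"
  define q where "q = sqrt L"
  have p: "p > 0" and q: "q > 0" using J L by (auto simp: p_def q_def card_gt_0_iff)
  have p2: "real (card J) = p\<^sup>2" and q2: "L = q\<^sup>2" using L by (auto simp: p_def q_def)
  have pq: "sqrt (real (card J) * L) = p * q" by (simp add: p_def q_def real_sqrt_mult)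
  \<comment> \<open>This gives the Chernoff parameter \<open>(1 - y) / 2 = q / (p + 2 * q)\<close>,
    for which the exponent at the level \<open>p\<^sup>2 + 2 * p * q + 2 * q\<^sup>2\<close>
    collapses to \<open>- q\<^sup>2\<close>.\<close>
  define y where "y = p / (p + 2 * q)"
  have y: "0 < y" "y < 1" using p q by (auto simp: y_def)
  have th: "(1 - y) / 2 = q / (p + 2 * q)" using p q by (simp add: y_def field_simps)
  have "0 < (1 - y) / 2" using y by simp
  from Chernoff_ineq_ge[OF this, of "space gauss_PiM" "\<lambda>w. \<Sum>i\<in>J. (w i)\<^sup>2" "p\<^sup>2 + 2 * (p * q) + 2 * q\<^sup>2"]
  have "prob {w\<in>space gauss_PiM. p\<^sup>2 + 2 * (p * q) + 2 * q\<^sup>2 \<le> (\<Sum>i\<in>J. (w i)\<^sup>2)}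
      \<le> exp (- ((1 - y) / 2) * (p\<^sup>2 + 2 * (p * q) + 2 * q\<^sup>2)) * (1 / sqrt y) ^ card J"
    using gauss_PiM_mgf_sum_squares[OF y(1), of J]
      integrable_mult_indicator[OF sets.top gauss_PiM_mgf_sum_squares(1)[OF y(1), of J]]
    by (simp add: set_integral_space set_integrable_def)
  also have "(1 / sqrt y) ^ card J \<le> exp (p\<^sup>2 * ((1 / y - y) / 4))"
  proof -
    have "1 / sqrt y = exp (- ln y / 2)"
      using y by (simp add: exp_minus ln_sqrt[symmetric] inverse_eq_divide)
    also have "\<dots> \<le> exp ((1 / y - y) / 4)"
      using neg_ln_le[of y] y by simp
    finally have "(1 / sqrt y) ^ card J \<le> exp ((1 / y - y) / 4) ^ card J"
      using y by (intro power_mono) auto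
    then show ?thesis by (simp add: exp_of_nat_mult[symmetric] p2)
  qed
  also have "exp (- ((1 - y) / 2) * (p\<^sup>2 + 2 * (p * q) + 2 * q\<^sup>2)) * exp (p\<^sup>2 * ((1 / y - y) / 4)) = exp (- (q\<^sup>2))"
  proof -
    have "1 / y - y = 4 * q * (p + q) / (p * (p + 2 * q))"
      using p q by (simp add: y_def field_simps power2_eq_square)
    then have "p\<^sup>2 * ((1 / y - y) / 4) = p * (q * (p + q)) / (p + 2 * q)"
      using p by (simp add: power2_eq_square)
    then have "- ((1 - y) / 2) * (p\<^sup>2 + 2 * (p * q) + 2 * q\<^sup>2) + p\<^sup>2 * ((1 / y - y) / 4)
        = (p * (q * (p + q)) - q * (p\<^sup>2 + 2 * (p * q) + 2 * q\<^sup>2)) / (p + 2 * q)"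
      unfolding th by (simp add: diff_divide_distrib)
    also have "p * (q * (p + q)) - q * (p\<^sup>2 + 2 * (p * q) + 2 * q\<^sup>2) = - (q\<^sup>2) * (p + 2 * q)"
      by (simp add: algebra_simps power2_eq_square)
    finally have "- ((1 - y) / 2) * (p\<^sup>2 + 2 * (p * q) + 2 * q\<^sup>2) + p\<^sup>2 * ((1 / y - y) / 4) = - (q\<^sup>2)"
      using p q by simp
    then show ?thesis by (simp add: exp_add[symmetric])
  qed
  finally show ?thesis unfolding pq by (simp add: p2 q2)
qed

section \<open>Quadratic forms of the symmetric Gaussian matrix\<close>

text \<open>Swapping the pair exchanges the two strict triangles, so a symmetric sum folds onto the
  upper triangle with weight 2, where the independent matrix entries live.\<close>

lemma sum_symmetric_pairs:
  fixes f :: "'d::{finite,linorder} \<Rightarrow> 'd \<Rightarrow> real"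
  assumes "\<And>j k. f j k = f k j"
  shows "(\<Sum>(j, k)\<in>UNIV. if j = k then f j j else if j < k then 2 * f j k else 0)
    = (\<Sum>j\<in>UNIV. \<Sum>k\<in>UNIV. f j k)"
proof -
  let ?up = "\<lambda>(j, k). if j < k then f j k else 0"
  let ?lo = "\<lambda>(j, k). if k < j then f j k else 0"
  have "(\<Sum>p\<in>UNIV. ?up p) = (\<Sum>p\<in>UNIV. ?lo p)"
    by (rule sum.reindex_bij_witness[of _ prod.swap prod.swap]) (auto simp: assms)
  moreover have "(\<Sum>(j, k)\<in>UNIV. if j = k then f j j else if j < k then 2 * f j k else 0)
      = (\<Sum>p\<in>UNIV. (case p of (j, k) \<Rightarrow> if j = k then f j j else 0) + (?up p + ?up p))"
    by (intro sum.cong) auto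
  moreover have "(\<Sum>(j, k)\<in>UNIV. f j k)
      = (\<Sum>p\<in>UNIV. (case p of (j, k) \<Rightarrow> if j = k then f j j else 0) + (?up p + ?lo p))"
    by (intro sum.cong) (auto simp: not_less order.order_iff_strict)
  ultimately show ?thesis
    by (simp add: sum.distrib sum.cartesian_product sum_distrib_left[symmetric])
qed

text \<open>The quadratic form of \<open>noise_W\<close> at \<open>v\<close> as a linear form in the
  independent entries on and above the diagonal; all other coordinates get weight 0.\<close>

definition quad_coef :: "real^('d::{finite,linorder}) \<Rightarrow> 'd + 'd \<times> 'd \<Rightarrow> real" where
  "quad_coef v = case_sum (\<lambda>_. 0)
     (\<lambda>(j, k). if j = k then v$j * v$j else if j < k then 2 * (v$j * v$k) else 0)"

lemma sum_UNIV_sum_type: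
  "(\<Sum>i\<in>(UNIV :: ('a::finite + 'b::finite) set). f i)
    = (\<Sum>i\<in>UNIV. f (Inl i)) + (\<Sum>i\<in>UNIV. (f (Inr i) :: real))"
  by (simp add: UNIV_Plus_UNIV[symmetric] sum.Plus del: UNIV_Plus_UNIV)

lemma sum_UNIV_option:
  "(\<Sum>i\<in>(UNIV :: 'a::finite option set). f i) = f None + (\<Sum>i\<in>UNIV. (f (Some i) :: real))"
  by (simp add: UNIV_option_conv sum.reindex)

lemma noise_W_quadform:
  "v \<bullet> (noise_W w *v v) = lin_form (quad_coef v) w"
proof -
  have "v \<bullet> (noise_W w *v v) = (\<Sum>j\<in>UNIV. \<Sum>k\<in>UNIV. v$j * v$k * noise_W w $ j $ k)"
    by (simp add: inner_vec_def matrix_vector_mult_def sum_distrib_left mult_ac)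
  also have "\<dots> = (\<Sum>(j, k)\<in>UNIV. if j = k then v$j * v$j * noise_W w $ j $ j
      else if j < k then 2 * (v$j * v$k * noise_W w $ j $ k) else 0)"
    by (subst sum_symmetric_pairs) (auto simp: noise_W_def mult_ac)
  also have "\<dots> = lin_form (quad_coef v) w"
    unfolding lin_form_def sum_UNIV_sum_type quad_coef_def
    by (auto intro!: sum.cong simp: noise_W_def)
  finally show ?thesis .
qed

lemma noise_W_symmetric: "x \<bullet> (noise_W w *v y) = y \<bullet> (noise_W w *v x)"
proof -
  have "noise_W w $ j $ k = noise_W w $ k $ j" for j k by (auto simp: noise_W_def)
  then have "transpose (noise_W w) = noise_W w" by (simp add: transpose_def vec_eq_iff)
  then show ?thesis
    by (metis dot_lmul_matrix inner_commute vector_transpose_matrix transpose_matrix_vector)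
qed

text \<open>Above the diagonal the coefficients multiply to weight 4, that is, 2 for each ordered
  pair. A diagonal entry has weight 1 instead of 2, and the subtracted sum corrects this.\<close>

lemma quad_coef_covariance:
  fixes u v :: "real^'d::{finite,linorder}"
  shows "(\<Sum>i\<in>UNIV. quad_coef u i * quad_coef v i) = 2 * (u \<bullet> v)\<^sup>2 - (\<Sum>j\<in>UNIV. (u$j * v$j)\<^sup>2)"
proof -
  define x where "x j = u$j * v$j" for j
  have "(\<Sum>i\<in>UNIV. quad_coef u i * quad_coef v i)
      = (\<Sum>p\<in>UNIV. 2 * (case p of (j, k) \<Rightarrow> if j = k then x j * x j else if j < k then 2 * (x j * x k) else 0)
          - (case p of (j, k) \<Rightarrow> if j = k then (x j)\<^sup>2 else 0))"
    unfolding sum_UNIV_sum_type quad_coef_def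
    by (auto intro!: sum.cong simp: x_def power2_eq_square)
  also have "\<dots> = 2 * (\<Sum>j\<in>UNIV. \<Sum>k\<in>UNIV. x j * x k) - (\<Sum>j\<in>UNIV. \<Sum>k\<in>UNIV. if j = k then (x j)\<^sup>2 else 0)"
  proof -
    have "(\<Sum>(j, k)\<in>UNIV. if j = k then x j * x j else if j < k then 2 * (x j * x k) else 0)
        = (\<Sum>j\<in>UNIV. \<Sum>k\<in>UNIV. x j * x k)"
      by (rule sum_symmetric_pairs) (rule mult.commute)
    moreover have "(\<Sum>(j, k)\<in>UNIV. if j = k then (x j)\<^sup>2 else 0)
        = (\<Sum>j\<in>UNIV. \<Sum>k\<in>UNIV. if j = k then (x j)\<^sup>2 else 0)"
      by (simp only: sum.cartesian_product UNIV_Times_UNIV)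
    ultimately show ?thesis
      unfolding sum_subtractf sum_distrib_left[symmetric] by simp
  qed
  also have "(\<Sum>j\<in>UNIV. \<Sum>k\<in>UNIV. x j * x k) = (u \<bullet> v)\<^sup>2"
    by (simp add: x_def inner_vec_def power2_eq_square sum_product)
  finally show ?thesis by (simp add: x_def)
qed

section \<open>Comparison with a linear Gaussian process\<close>

text \<open>The coordinate \<^term>\<open>None\<close> carries an auxiliary Gaussian which, with the weight
  \<open>sqrt (2 + \<Sum> u\<^sub>j\<^sup>4)\<close>, makes all variances equal to 4.\<close>
definition lifted_quad_coef :: "real \<Rightarrow> real \<Rightarrow> real^('d::{finite,linorder}) \<Rightarrow> ('d + 'd \<times> 'd) option \<Rightarrow> real" where
  "lifted_quad_coef \<sigma> \<tau> u = case_option (\<tau> * sqrt (2 + (\<Sum>j\<in>UNIV. (u$j)^4))) (\<lambda>i. \<sigma> * quad_coef u i)"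

text \<open>The comparison process \<open>2 g \<bullet> u\<close>, with \<open>g\<close> placed in
  the \<open>Inl\<close> coordinates, where \<open>lifted_quad_coef\<close> vanishes; this makes the
  two families independent.\<close>

definition chevet_coef :: "real^('d::{finite,linorder}) \<Rightarrow> ('d + 'd \<times> 'd) option \<Rightarrow> real" where
  "chevet_coef u = case_option 0 (case_sum (\<lambda>j. 2 * u$j) (\<lambda>_. 0))"

text \<open>The signs \<sigma> and \<tau> enter only squared, so one covariance comparison serves
  all four sign choices.\<close>

lemma lifted_quad_coef_covariance:
  fixes u v :: "real^'d::{finite,linorder}"
  assumes "\<sigma>\<^sup>2 = 1" "\<tau>\<^sup>2 = 1"
  shows "(\<Sum>i\<in>UNIV. lifted_quad_coef \<sigma> \<tau> u i * lifted_quad_coef \<sigma> \<tau> v i)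
    = sqrt (2 + (\<Sum>j\<in>UNIV. (u$j)^4)) * sqrt (2 + (\<Sum>j\<in>UNIV. (v$j)^4))
      + 2 * (u \<bullet> v)\<^sup>2 - (\<Sum>j\<in>UNIV. (u$j * v$j)\<^sup>2)"
proof -
  have "(\<Sum>i\<in>UNIV. lifted_quad_coef \<sigma> \<tau> u i * lifted_quad_coef \<sigma> \<tau> v i)
    = \<tau>\<^sup>2 * (sqrt (2 + (\<Sum>j\<in>UNIV. (u$j)^4)) * sqrt (2 + (\<Sum>j\<in>UNIV. (v$j)^4)))
      + \<sigma>\<^sup>2 * (\<Sum>i\<in>UNIV. quad_coef u i * quad_coef v i)"
    unfolding sum_UNIV_option lifted_quad_coef_def
    by (simp add: power2_eq_square sum_distrib_left mult_ac)
  then show ?thesis using assms by (simp add: quad_coef_covariance)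
qed

lemma chevet_coef_covariance:
  "(\<Sum>i\<in>UNIV. chevet_coef u i * chevet_coef v i) = 4 * (u \<bullet> v)"
  unfolding sum_UNIV_option chevet_coef_def sum_UNIV_sum_type
  by (simp add: inner_vec_def sum_distrib_left mult_ac)

lemma chevet_coef_orthogonal:
  "(\<Sum>i\<in>UNIV. lifted_quad_coef \<sigma> \<tau> u i * chevet_coef v i) = 0"
  unfolding sum_UNIV_option chevet_coef_def lifted_quad_coef_def sum_UNIV_sum_type quad_coef_def
  by simp

text \<open>Cauchy-Schwarz and the arithmetic-geometric mean inequality bound the product of square
  roots below by \<open>2 + ?r\<close>; what remains is
  \<open>2 * (u \<bullet> v - 1)\<^sup>2 \<ge> 0\<close>. This is the covariance hypothesis of
  Slepian's inequality.\<close>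

lemma four_inner_le_lifted_covariance:
  fixes u v :: "real^'d::{finite,linorder}"
  assumes "norm u = 1" "norm v = 1"
  shows "4 * (u \<bullet> v) \<le> sqrt (2 + (\<Sum>j\<in>UNIV. (u$j)^4)) * sqrt (2 + (\<Sum>j\<in>UNIV. (v$j)^4))
      + 2 * (u \<bullet> v)\<^sup>2 - (\<Sum>j\<in>UNIV. (u$j * v$j)\<^sup>2)"
proof -
  let ?p = "\<Sum>j\<in>UNIV. (u$j)^4" and ?q = "\<Sum>j\<in>UNIV. (v$j)^4" and ?r = "\<Sum>j\<in>UNIV. (u$j * v$j)\<^sup>2"
  have pq: "0 \<le> ?p" "0 \<le> ?q" "0 \<le> ?r" by (auto intro!: sum_nonneg)
  have "?r\<^sup>2 \<le> ?p * ?q"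
    using Cauchy_Schwarz_ineq_sum[of "\<lambda>j. (u$j)\<^sup>2" "\<lambda>j. (v$j)\<^sup>2" UNIV]
    by (simp add: power_mult_distrib)
  moreover have "2 * ?r \<le> ?p + ?q"
    unfolding sum_distrib_left sum.distrib[symmetric]
  proof (rule sum_mono)
    fix j
    have "0 \<le> ((u$j)\<^sup>2 - (v$j)\<^sup>2)\<^sup>2" by simp
    also have "\<dots> = (u$j)^4 + (v$j)^4 - 2 * (u$j * v$j)\<^sup>2" by (simp add: power2_eq_square power4_eq_xxxx algebra_simps)
    finally show "2 * (u$j * v$j)\<^sup>2 \<le> (u$j)^4 + (v$j)^4" by simp
  qed
  ultimately have "(2 + ?r)\<^sup>2 \<le> (2 + ?p) * (2 + ?q)"
    by (simp add: power2_eq_square algebra_simps)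
  then have "2 + ?r \<le> sqrt ((2 + ?p) * (2 + ?q))"
    by (rule real_le_rsqrt)
  then have "2 + ?r \<le> sqrt (2 + ?p) * sqrt (2 + ?q)" by (simp add: real_sqrt_mult)
  moreover have "0 \<le> 2 * (u \<bullet> v - 1)\<^sup>2" by simp
  then have "4 * (u \<bullet> v) \<le> 2 + 2 * (u \<bullet> v)\<^sup>2" by (simp add: power2_eq_square algebra_simps)
  ultimately show ?thesis by linarith
qed

lemma lifted_quad_tail:
  fixes N :: "(real^'d::{finite,linorder}) set"
  assumes N: "finite N" "\<And>u. u \<in> N \<Longrightarrow> norm u = 1"
    and \<sigma>\<tau>: "\<sigma>\<^sup>2 = 1" "\<tau>\<^sup>2 = 1" and L: "0 < L"
    and t: "2 * sqrt (real CARD('d)) + 2 * sqrt (2 * L) < t"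
  shows "measure gauss_PiM {w\<in>space gauss_PiM. \<exists>u\<in>N. t < lin_form (lifted_quad_coef \<sigma> \<tau> u) w} \<le> exp (- L)"
proof -
  interpret prob_space "gauss_PiM :: (('d + 'd \<times> 'd) option \<Rightarrow> real) measure" by (rule prob_space_gauss_PiM)
  define s where "s = 2 * sqrt (real CARD('d)) + 2 * sqrt (2 * L)"
  have s0: "0 \<le> s" using L by (simp add: s_def)
  define J where "J = (range (\<lambda>j::'d. Some (Inl j)) :: ('d + 'd \<times> 'd) option set)"
  have cardJ: "card J = CARD('d)" unfolding J_def by (rule card_image) (simp add: inj_def)
  have sumJ: "(\<Sum>i\<in>J. (w i)\<^sup>2) = (\<Sum>j\<in>UNIV. (w (Some (Inl j)))\<^sup>2)" for w :: "_ \<Rightarrow> real"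
    unfolding J_def by (subst sum.reindex) (auto simp: inj_def)
  have self: "u \<bullet> u = 1" if "u \<in> N" for u using N(2)[OF that] by (simp add: norm_eq_1)
  have "prob {w\<in>space gauss_PiM. \<exists>u\<in>N. t < lin_form (lifted_quad_coef \<sigma> \<tau> u) w}
      \<le> prob {w\<in>space gauss_PiM. \<exists>u\<in>N. s < lin_form (chevet_coef u) w}"
  proof (rule slepian_tail[OF N(1)])
    fix u v assume uv: "u \<in> N" "v \<in> N"
    show "(\<Sum>i\<in>UNIV. chevet_coef u i * chevet_coef v i)
        \<le> (\<Sum>i\<in>UNIV. lifted_quad_coef \<sigma> \<tau> u i * lifted_quad_coef \<sigma> \<tau> v i)"
      unfolding chevet_coef_covariance lifted_quad_coef_covariance[OF \<sigma>\<tau>]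
      using four_inner_le_lifted_covariance N uv by blast
  next
    fix u assume u: "u \<in> N"
    have "(u$j * u$j)\<^sup>2 = (u$j)^4" for j by (simp add: power2_eq_square power4_eq_xxxx)
    moreover have "0 \<le> (\<Sum>j\<in>UNIV. (u$j)^4)" by (intro sum_nonneg) auto
    ultimately show "(\<Sum>i\<in>UNIV. chevet_coef u i * chevet_coef u i)
        = (\<Sum>i\<in>UNIV. lifted_quad_coef \<sigma> \<tau> u i * lifted_quad_coef \<sigma> \<tau> u i)"
      unfolding chevet_coef_covariance lifted_quad_coef_covariance[OF \<sigma>\<tau>] by (simp add: self[OF u])
  qed (use t in \<open>auto simp: chevet_coef_orthogonal s_def\<close>)
  also have "\<dots> \<le> prob {w\<in>space gauss_PiM. real (card J) + 2 * sqrt (real (card J) * L) + 2 * L \<le> (\<Sum>i\<in>J. (w i)\<^sup>2)}"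
  proof (rule finite_measure_mono)
    show "{w\<in>space gauss_PiM. \<exists>u\<in>N. s < lin_form (chevet_coef u) w}
      \<subseteq> {w\<in>space gauss_PiM. real (card J) + 2 * sqrt (real (card J) * L) + 2 * L \<le> (\<Sum>i\<in>J. (w i)\<^sup>2)}"
    proof safe
      fix w :: "('d + 'd \<times> 'd) option \<Rightarrow> real" and u assume u: "u \<in> N" and s: "s < lin_form (chevet_coef u) w"
      have "lin_form (chevet_coef u) w = 2 * (\<Sum>j\<in>UNIV. u$j * w (Some (Inl j)))"
        unfolding lin_form_def sum_UNIV_option chevet_coef_def sum_UNIV_sum_type
        by (simp add: sum_distrib_left mult_ac)
      then have "s / 2 \<le> (\<Sum>j\<in>UNIV. u$j * w (Some (Inl j)))" using s by simp
      then have "(s / 2)\<^sup>2 \<le> (\<Sum>j\<in>UNIV. u$j * w (Some (Inl j)))\<^sup>2"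
        using s0 by (intro power_mono) auto
      also have "\<dots> \<le> (\<Sum>j\<in>UNIV. (u$j)\<^sup>2) * (\<Sum>j\<in>UNIV. (w (Some (Inl j)))\<^sup>2)"
        by (rule Cauchy_Schwarz_ineq_sum)
      also have "(\<Sum>j\<in>UNIV. (u$j)\<^sup>2) = 1"
        using self[OF u] by (simp add: inner_vec_def power2_eq_square)
      finally have 1: "(s / 2)\<^sup>2 \<le> (\<Sum>i\<in>J. (w i)\<^sup>2)" by (simp add: sumJ)
      define p where "p = sqrt (real CARD('d))"
      define q where "q = sqrt L"
      have pq: "0 \<le> p" "0 \<le> q" "sqrt (real CARD('d) * L) = p * q" "real CARD('d) = p\<^sup>2" "L = q\<^sup>2"
        using L by (auto simp: p_def q_def real_sqrt_mult)
      have s2: "s / 2 = p + sqrt 2 * q" by (simp add: s_def p_def q_def real_sqrt_mult)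
      \<comment> \<open>The square of \<open>p + sqrt 2 * q\<close> dominates the chi-square
        threshold because \<open>sqrt 2 \<ge> 1\<close> in the cross term.\<close>
      have "(s / 2)\<^sup>2 = p\<^sup>2 + 2 * sqrt 2 * (p * q) + 2 * q\<^sup>2"
        unfolding s2 by (simp add: power2_sum power_mult_distrib)
      moreover have "2 * (p * q) \<le> 2 * sqrt 2 * (p * q)"
        using pq by (intro mult_right_mono) auto
      ultimately show "real (card J) + 2 * sqrt (real (card J) * L) + 2 * L \<le> (\<Sum>i\<in>J. (w i)\<^sup>2)"
        using 1 pq(4,5) unfolding cardJ pq(3) by linarith
    qed
  qed measurable
  also have "\<dots> \<le> exp (- L)"
    by (rule chi_square_tail[OF _ L]) (simp add: J_def)
  finally show ?thesis .
qed

section \<open>Tail bound for the noise matrix\<close>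

lemma noise_space_eq: "noise_space = gauss_PiM"
  by (simp add: noise_space_def)

lemma noise_W_quadform_tail:
  fixes N :: "(real^'d::{finite,linorder}) set"
  assumes N: "finite N" "\<And>u. u \<in> N \<Longrightarrow> norm u = 1" and L: "0 < L"
    and t: "2 * sqrt (real CARD('d)) + 2 * sqrt (2 * L) < t"
  shows "measure noise_space {w\<in>space noise_space. \<exists>u\<in>N. t < \<bar>u \<bullet> (noise_W w *v u)\<bar>} \<le> 4 * exp (- L)"
proof -
  let ?B = "gauss_PiM :: (('d + 'd \<times> 'd) option \<Rightarrow> real) measure"
  let ?G = "gauss_PiM :: ('d + 'd \<times> 'd \<Rightarrow> real) measure"
  interpret prob_space ?B by (rule prob_space_gauss_PiM)
  let ?S = "{w\<in>space ?G. \<exists>u\<in>N. t < \<bar>lin_form (quad_coef u) w\<bar>}"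
  let ?E = "\<lambda>\<sigma> \<tau>. {w\<in>space ?B. \<exists>u\<in>N. t < lin_form (lifted_quad_coef \<sigma> \<tau> u) w}"
  have [measurable]: "?S \<in> sets ?G" using N(1) by measurable
  have E [measurable]: "?E \<sigma> \<tau> \<in> sets ?B" for \<sigma> \<tau> using N(1) by measurable
  have res: "(\<lambda>w i. w (Some i)) \<in> ?B \<rightarrow>\<^sub>M ?G"
    by (rule measurable_PiM_single') (auto simp: space_PiM)
  \<comment> \<open>Forgetting the coordinate \<open>None\<close> maps the enlarged Gaussian space
    onto the original one, so the event can be measured upstairs.\<close>
  have "distr ?B ?G (\<lambda>w. \<lambda>i\<in>UNIV. w (Some i)) = ?G"
    by (rule distr_PiM_reindex) (auto intro: prob_space_normal_density)
  then have "measure ?G ?S = measure (distr ?B ?G (\<lambda>w i. w (Some i))) ?S"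
    by (simp add: restrict_UNIV)
  also have "\<dots> = prob ((\<lambda>w i. w (Some i)) -` ?S \<inter> space ?B)"
    by (rule measure_distr[OF res]) simp
  also have "\<dots> \<le> prob (?E 1 1 \<union> ?E 1 (-1) \<union> ?E (-1) 1 \<union> ?E (-1) (-1))"
  proof (rule finite_measure_mono)
    show "(\<lambda>w i. w (Some i)) -` ?S \<inter> space ?B \<subseteq> ?E 1 1 \<union> ?E 1 (-1) \<union> ?E (-1) 1 \<union> ?E (-1) (-1)"
    proof
      fix w assume w: "w \<in> (\<lambda>w i. w (Some i)) -` ?S \<inter> space ?B"
      then obtain u where u: "u \<in> N" and tu: "t < \<bar>lin_form (quad_coef u) (\<lambda>i. w (Some i))\<bar>" by auto
      have lf: "lin_form (lifted_quad_coef \<sigma> \<tau> u) w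
          = \<tau> * (sqrt (2 + (\<Sum>j\<in>UNIV. (u$j)^4)) * w None) + \<sigma> * lin_form (quad_coef u) (\<lambda>i. w (Some i))" for \<sigma> \<tau>
        unfolding lin_form_def sum_UNIV_option lifted_quad_coef_def by (simp add: sum_distrib_left mult_ac)
      \<comment> \<open>Take \<sigma> as the sign of the quadratic form and \<tau> as the sign of
        \<open>w None\<close>: the auxiliary term then only adds to the modulus. The four sign pairs
        produce the factor 4.\<close>
      have "t < lin_form (lifted_quad_coef 1 1 u) w \<or> t < lin_form (lifted_quad_coef 1 (-1) u) w
          \<or> t < lin_form (lifted_quad_coef (-1) 1 u) w \<or> t < lin_form (lifted_quad_coef (-1) (-1) u) w"
        using tu unfolding lf by linarith
      then show "w \<in> ?E 1 1 \<union> ?E 1 (-1) \<union> ?E (-1) 1 \<union> ?E (-1) (-1)"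
        using w u by blast
    qed
  qed measurable
  also have "\<dots> \<le> prob (?E 1 1) + prob (?E 1 (-1)) + prob (?E (-1) 1) + prob (?E (-1) (-1))"
    by (intro order_trans[OF measure_Un_le] add_mono order_refl) measurable
  also have "\<dots> \<le> exp (- L) + exp (- L) + exp (- L) + exp (- L)"
    by (intro add_mono lifted_quad_tail[OF N _ _ L t]) auto
  finally show ?thesis
    unfolding noise_space_eq noise_W_quadform by simp
qed

section \<open>The error of SeparateCov\<close>

lemma logc_ge_1: "1 \<le> logc x"
proof (cases "x \<le> exp 1")
  case False
  then have "ln (exp 1) \<le> ln x" using exp_gt_zero[of "1::real"] by (subst ln_le_cancel_iff) linarith+
  then show ?thesis using False by (simp add: logc_def)
qed (simp add: logc_def)

lemma ln_le_logc:
  assumes "0 < x"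
  shows "ln x \<le> logc x"
proof (cases "x \<le> exp 1")
  case True
  then have "ln x \<le> ln (exp 1)" using assms by (subst ln_le_cancel_iff) auto
  then show ?thesis using True by (simp add: logc_def)
qed (simp add: logc_def)

text \<open>The slack 8 is 2 from the term with \<open>d powr (1/6)\<close> and 6 from the quotient,
  whose denominator is at most \<open>1 + \<epsilon>\<close>.\<close>

lemma upsilon_fn_lower:
  assumes "1 \<le> d"
  shows "2 * sqrt d + 2 * sqrt (2 * logc (1 / \<beta>)) + 8 \<le> upsilon_fn d \<beta>"
proof -
  define \<epsilon> where "\<epsilon> = (logc d / d) powr (1 / 3)"
  have \<epsilon>: "0 < \<epsilon>" using assms logc_ge_1[of d] by (simp add: \<epsilon>_def)
  have "1 * 1 \<le> d powr (1 / 6) * (logc d) powr (1 / 3)"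
    using assms logc_ge_1[of d] by (intro mult_mono ge_one_powr_ge_zero) auto
  moreover have "6 \<le> 6 * (1 + \<epsilon>) * sqrt (logc d) / sqrt (ln (1 + \<epsilon>))"
  proof -
    have ln0: "0 < ln (1 + \<epsilon>)" using \<epsilon> by simp
    have "(1 + \<epsilon>)\<^sup>2 = 1 + 2 * \<epsilon> + \<epsilon>\<^sup>2" by (simp add: power2_sum)
    then have "ln (1 + \<epsilon>) \<le> (1 + \<epsilon>)\<^sup>2"
      using ln_add_one_self_le_self[of \<epsilon>] \<epsilon> zero_le_power2[of \<epsilon>] by linarith
    then have "sqrt (ln (1 + \<epsilon>)) \<le> 1 + \<epsilon>" using \<epsilon> by (intro real_le_lsqrt) auto
    also have "1 + \<epsilon> \<le> (1 + \<epsilon>) * sqrt (logc d)"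
      using \<epsilon> logc_ge_1[of d] mult_left_mono[of 1 "sqrt (logc d)" "1 + \<epsilon>"] by simp
    finally show ?thesis using ln0 by (simp add: field_simps)
  qed
  ultimately show ?thesis
    unfolding upsilon_fn_def Let_def \<epsilon>_def[symmetric] by linarith
qed

theorem mainTheorem3:
  fixes X :: "nat \<Rightarrow> real^'d::{finite,linorder}"
    and n :: nat and \<rho> \<beta> :: real
    and P :: "'d rmat" and lam :: "'d \<Rightarrow> real"
    and Pt :: "('d + 'd \<times> 'd \<Rightarrow> real) \<Rightarrow> 'd rmat"
  assumes "n > 0" and "\<rho> > 0" and "0 < \<beta>" and "\<beta> < 1"
    and "\<forall>i<n. norm (X i) \<le> 1"
    and "sorted_eig (emp_cov n X) P lam"
    and "\<forall>\<omega>\<in>space noise_space. \<exists>mu.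
           sorted_eig (gauss_cov n X (\<rho>/2) (noise_W \<omega>)) (Pt \<omega>) mu"
  shows "\<exists>E\<in>sets noise_space. measure noise_space E \<ge> 1 - \<beta> \<and>
    (\<forall>\<omega>\<in>E. frob_norm (sep_cov_out n \<rho> lam (noise_Y \<omega>) (Pt \<omega>) - emp_cov n X)
       \<le> 2 powr 1.25 * sqrt (emp_tr n X) / (\<rho> powr (1/4) * sqrt (real n))
            * sqrt (upsilon_fn (real CARD('d)) (\<beta>/2))
         + sqrt 2 / (sqrt \<rho> * real n) * eta_fn (real CARD('d)) (\<beta>/2))"
proof -
  let ?G = "noise_space :: ('d + 'd \<times> 'd \<Rightarrow> real) measure"
  interpret prob_space ?G unfolding noise_space_eq by (rule prob_space_gauss_PiM)
  define c where "c = sqrt 2 / (sqrt \<rho> * real n)"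
  have c0: "0 \<le> c" using assms by (simp add: c_def)
  define T where "T = upsilon_fn (real CARD('d)) (\<beta>/2)"
  \<comment> \<open>The argument is \<open>1 / (\<beta>/2)\<close>, so \<open>L\<close> is the
    logarithm inside both \<open>upsilon_fn\<close> and \<open>eta_fn\<close>, each of the two
    events being allotted probability \<open>\<beta>/2\<close>.\<close>
  define L where "L = logc (2 / \<beta>)"
  have L1: "1 \<le> L" by (simp add: L_def logc_ge_1)
  have expL: "exp (- L) \<le> \<beta> / 2"
  proof -
    have "exp (- L) \<le> exp (- ln (2 / \<beta>))" using ln_le_logc[of "2 / \<beta>"] assms by (simp add: L_def)
    also have "\<dots> = \<beta> / 2" using assms by (simp add: exp_minus)
    finally show ?thesis .
  qed
  have T: "2 * sqrt (real CARD('d)) + 2 * sqrt (2 * L) + 8 \<le> T"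
    using upsilon_fn_lower[of "real CARD('d)" "\<beta>/2"] unfolding T_def L_def by (simp add: Suc_le_eq)
  have T8: "8 \<le> T" using T L1 by (smt (verit) real_sqrt_ge_zero of_nat_0_le_iff)
  \<comment> \<open>With this mesh, passing to the net costs exactly 2 in the threshold.\<close>
  define \<delta> where "\<delta> = 1 / T"
  have \<delta>: "0 < \<delta>" "2 * \<delta> < 1" "(1 - 2 * \<delta>) * T = T - 2"
    using T8 by (auto simp: \<delta>_def field_simps)
  obtain N :: "(real^('d::{finite,linorder})) set" where N: "finite N" "\<And>v. v \<in> N \<Longrightarrow> norm v = 1"
      "\<And>x. norm x = 1 \<Longrightarrow> \<exists>v\<in>N. norm (x - v) \<le> \<delta>"
    using sphere_finite_net[OF \<delta>(1)] by blast
  define A where "A = {w\<in>space ?G. \<exists>u\<in>N. T - 2 < \<bar>u \<bullet> (noise_W w *v u)\<bar>}"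
  define J where "J = (range Inl :: ('d + 'd \<times> 'd) set)"
  have cardJ: "card J = CARD('d)" unfolding J_def by (rule card_image) (simp add: inj_def)
  have sumJ: "(\<Sum>i\<in>J. (w i)\<^sup>2) = (\<Sum>j\<in>UNIV. (noise_Y w j)\<^sup>2)" for w :: "'d + 'd \<times> 'd \<Rightarrow> real"
    unfolding J_def noise_Y_def by (subst sum.reindex) (auto simp: inj_def)
  define B where "B = {w\<in>space ?G. real (card J) + 2 * sqrt (real (card J) * L) + 2 * L \<le> (\<Sum>i\<in>J. (w i)\<^sup>2)}"
  have [measurable]: "A \<in> sets ?G"
    unfolding A_def noise_W_quadform noise_space_eq using N(1) by measurable
  have [measurable]: "B \<in> sets ?G"
    unfolding B_def noise_space_eq by measurable
  \<comment> \<open>Raising \<open>L\<close> by 2 absorbs the factor 4, as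
    \<open>4 * exp (- 2) \<le> 1\<close>, and raises the threshold by at most 4. Together with the 2
    for the net this stays strictly below the slack 8.\<close>
  have "prob A \<le> 4 * exp (- (L + 2))"
    unfolding A_def
  proof (rule noise_W_quadform_tail[OF N(1,2)])
    have "sqrt (2 * (L + 2)) \<le> sqrt (2 * L) + sqrt 4"
      using sqrt_add_le_add_sqrt[of "2 * L" 4] L1 by (simp add: algebra_simps)
    then show "2 * sqrt (real CARD('d)) + 2 * sqrt (2 * (L + 2)) < T - 2"
      using T by simp
  qed (use L1 in auto)
  also have "\<dots> = exp (- L) * (4 * exp (- 2))" by (simp add: exp_add[symmetric] mult_ac)
  also have "\<dots> \<le> exp (- L) * 1"
  proof (rule mult_left_mono)
    have "2 ^ 2 \<le> exp (1::real) ^ 2" using exp_ge_add_one_self[of "1::real"] by (intro power_mono) auto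
    then have "4 \<le> exp (2::real)" by (simp add: exp_of_nat_mult[symmetric])
    then show "4 * exp (- 2) \<le> (1::real)" by (simp add: exp_minus field_simps)
  qed simp
  finally have A: "prob A \<le> \<beta> / 2" using expL by simp
  have B: "prob B \<le> \<beta> / 2"
  proof -
    have "prob B \<le> exp (- L)"
      unfolding B_def noise_space_eq by (rule chi_square_tail) (use L1 in \<open>auto simp: J_def\<close>)
    then show ?thesis using expL by simp
  qed
  show ?thesis
  proof (intro bexI conjI ballI)
    show "space ?G - (A \<union> B) \<in> sets ?G" by measurable
    have "prob (A \<union> B) \<le> \<beta>" using measure_Un_le[of A ?G B] A B by simp
    then show "1 - \<beta> \<le> prob (space ?G - (A \<union> B))" by (subst prob_compl) auto
    fix w assume w: "w \<in> space ?G - (A \<union> B)"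
    have q: "\<bar>x \<bullet> (noise_W w *v x)\<bar> \<le> T" if "norm x = 1" for x
    proof (rule quadform_net_bound[OF noise_W_symmetric _ \<delta>(1,2) _ that])
      show "\<exists>v\<in>N. norm v = 1 \<and> norm (x - v) \<le> \<delta>" if "norm x = 1" for x
        using N(2) N(3)[OF that] by blast
      show "\<bar>v \<bullet> (noise_W w *v v)\<bar> \<le> (1 - 2 * \<delta>) * T" if "v \<in> N" for v
        using w that unfolding \<delta>(3) A_def by (auto simp: not_less)
    qed
    obtain mu where mu: "sorted_eig (gauss_cov n X (\<rho>/2) (noise_W w)) (Pt w) mu"
      using assms(7) w by blast
    \<comment> \<open>Half of the budget goes to each release, so the matrix noise and the
      eigenvalue noise have the same scale \<open>c\<close>.\<close>
    have ceq: "1 / (sqrt (\<rho> / 2) * real n) = c"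
      using assms by (simp add: c_def real_sqrt_divide)
    have "norm (Pt w ** diag_mat (\<lambda>j. lam j + c * noise_Y w j) ** transpose (Pt w) - emp_cov n X)
        \<le> 2 * sqrt (c * T * emp_tr n X) + c * sqrt (\<Sum>j\<in>UNIV. (noise_Y w j)\<^sup>2)"
      using mu unfolding gauss_cov_def ceq
      by (rule sep_cov_error_deterministic[OF c0 assms(6) _ q])
    moreover have "sqrt (\<Sum>j\<in>UNIV. (noise_Y w j)\<^sup>2) \<le> eta_fn (real CARD('d)) (\<beta>/2)"
      using w unfolding eta_fn_def B_def sumJ cardJ L_def by auto
    then have "c * sqrt (\<Sum>j\<in>UNIV. (noise_Y w j)\<^sup>2) \<le> c * eta_fn (real CARD('d)) (\<beta>/2)"
      by (rule mult_left_mono[OF _ c0])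
    \<comment> \<open>The square root of \<open>c\<close> contributes \<open>2 powr (1/4)\<close>,
      which with the leading 2 gives the exponent 1.25.\<close>
    moreover have "2 * sqrt (c * T * emp_tr n X)
        = 2 powr 1.25 * sqrt (emp_tr n X) / (\<rho> powr (1/4) * sqrt (real n)) * sqrt T"
    proof -
      have r: "sqrt (sqrt x) = x powr (1 / 4)" if "0 < x" for x :: real
        using that by (simp add: powr_half_sqrt[symmetric] powr_powr)
      have "2 * 2 powr (1 / 4) = (2::real) powr 1.25"
        using powr_add[of "2::real" 1 "1 / 4"] by simp
      then show ?thesis
        using assms by (simp add: c_def real_sqrt_mult real_sqrt_divide r)
    qed
    ultimately show "frob_norm (sep_cov_out n \<rho> lam (noise_Y w) (Pt w) - emp_cov n X)
       \<le> 2 powr 1.25 * sqrt (emp_tr n X) / (\<rho> powr (1/4) * sqrt (real n))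
            * sqrt (upsilon_fn (real CARD('d)) (\<beta>/2))
         + sqrt 2 / (sqrt \<rho> * real n) * eta_fn (real CARD('d)) (\<beta>/2)"
      unfolding frob_norm_eq_norm sep_cov_out_def c_def[symmetric] T_def[symmetric] by linarith
  qed
qed

end
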